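(* Let $p$ be a prime and let $P$ be a $p$-group of order $p^n$, with $n>1$, and exponent $p$. Then there exists a finite solvable $p'$-group $N$ of Fitting height $n$ such that $P$ acts on $N$, $C_N(P)=1$, and the semidirect product $G=N\rtimes P$ has a redundant Sylow $p$-subgroup.
   Context: For a finite group $G$ and a prime $p$, $G_p$ denotes the set of $p$-elements of $G$ and $\mathrm{Syl}_p(G)$ the set of Sylow $p$-subgroups of $G$. $G$ is said to have a redundant Sylow $p$-subgroup if $G_p$ is contained in the union of the members of some proper subset of $\mathrm{Syl}_p(G)$. The Fitting height of a solvable group is the length of its Fitting series $1=F_0\le F_1\le\cdots$, where $F_i/F_{i-1}$ is the Fitting subgroup of $G/F_{i-1}$. *)

theory Defs
  imports "HOL-Algebra.Algebra"
begin

definition commutator_subgroup :: "('a, 'b) monoid_scheme \<Rightarrow> 'a set \<Rightarrow> 'a set \<Rightarrow> 'a set" where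
  "commutator_subgroup G H K = generate G
     (\<Union>h \<in> H. \<Union>k \<in> K. {h \<otimes>\<^bsub>G\<^esub> k \<otimes>\<^bsub>G\<^esub> inv\<^bsub>G\<^esub> h \<otimes>\<^bsub>G\<^esub> inv\<^bsub>G\<^esub> k})"

text \<open>Lower central series: gamma_1 = G (index 0 here), gamma_(i+1) = [gamma_i, G].\<close>
fun lower_central :: "('a, 'b) monoid_scheme \<Rightarrow> nat \<Rightarrow> 'a set" where
  "lower_central G 0 = carrier G"
| "lower_central G (Suc i) = commutator_subgroup G (lower_central G i) (carrier G)"

definition nilpotent :: "('a, 'b) monoid_scheme \<Rightarrow> bool" where
  "nilpotent G \<longleftrightarrow> group G \<and> (\<exists>n. lower_central G n = {\<one>\<^bsub>G\<^esub>})"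

definition fitting_subgroup :: "('a, 'b) monoid_scheme \<Rightarrow> 'a set" where
  "fitting_subgroup G = generate G
     (\<Union>{H. H \<lhd> G \<and> nilpotent (G\<lparr>carrier := H\<rparr>)})"

text \<open>Fitting series: F_0 = 1, F_(i+1) = preimage in G of F(G/F_i).\<close>
fun fitting_series :: "('a, 'b) monoid_scheme \<Rightarrow> nat \<Rightarrow> 'a set" where
  "fitting_series G 0 = {\<one>\<^bsub>G\<^esub>}"
| "fitting_series G (Suc i) = \<Union>(fitting_subgroup (G Mod fitting_series G i))"

definition fitting_height :: "('a, 'b) monoid_scheme \<Rightarrow> nat" where
  "fitting_height G = (LEAST n. fitting_series G n = carrier G)"

definition semidirect_product ::
  "('b, 'd) monoid_scheme \<Rightarrow> ('a, 'c) monoid_scheme \<Rightarrow> ('a \<Rightarrow> 'b \<Rightarrow> 'b) \<Rightarrow> ('b \<times> 'a) monoid" where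
  "semidirect_product N P \<phi> =
     \<lparr>carrier = carrier N \<times> carrier P,
      monoid.mult = (\<lambda>(a, x) (b, y). (a \<otimes>\<^bsub>N\<^esub> \<phi> x b, x \<otimes>\<^bsub>P\<^esub> y)),
      one = (\<one>\<^bsub>N\<^esub>, \<one>\<^bsub>P\<^esub>)\<rparr>"

definition fixed_points :: "('b, 'd) monoid_scheme \<Rightarrow> ('a, 'c) monoid_scheme \<Rightarrow> ('a \<Rightarrow> 'b \<Rightarrow> 'b) \<Rightarrow> 'b set" where
  "fixed_points N P \<phi> = {x \<in> carrier N. \<forall>g \<in> carrier P. \<phi> g x = x}"

definition p_elements :: "nat \<Rightarrow> ('a, 'b) monoid_scheme \<Rightarrow> 'a set" where
  "p_elements p G = {x \<in> carrier G. \<exists>k::nat. x [^]\<^bsub>G\<^esub> (p ^ k) = \<one>\<^bsub>G\<^esub>}"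

definition sylow_subgroups :: "nat \<Rightarrow> ('a, 'b) monoid_scheme \<Rightarrow> 'a set set" where
  "sylow_subgroups p G = {S. subgroup S G \<and> card S = p ^ multiplicity p (order G)}"

definition has_redundant_sylow :: "nat \<Rightarrow> ('a, 'b) monoid_scheme \<Rightarrow> bool" where
  "has_redundant_sylow p G \<longleftrightarrow>
     (\<exists>T. T \<subset> sylow_subgroups p G \<and> p_elements p G \<subseteq> \<Union>T)"

end

theory Submission
  imports Defs
begin

text \<open>
  The group \<open>N\<close> is built along a chief series of \<open>P\<close>. Suppose \<open>M < L\<close> are normal in \<open>P\<close> with
  \<open>L/M\<close> of order \<open>p\<close>, and \<open>P/L\<close> already acts fixed-point-freely on \<open>B\<close> of Fitting height \<open>k\<close>.
  Let \<open>r = |B| |P| + 1\<close> (only its coprimality to \<open>|B|\<close> and \<open>|P|\<close> matters) and let \<open>V\<close> consist of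
  the functions \<open>B \<rtimes> P \<rightarrow> \<int>/r\<close> that are right \<open>M\<close>-invariant and sum to zero over each coset of \<open>L\<close>,
  with the left translation action. Then \<open>M\<close> acts trivially on \<open>V\<close>, \<open>C\<^sub>V(L) = 0\<close>, and \<open>B\<close> acts faithfully
  and coprimely, so the Fitting subgroup of \<open>V \<rtimes> B\<close> is \<open>V\<close> and the Fitting height grows by one.

  If \<open>n > 1\<close>, every \<open>x \<in> P\<close> centralises a nontrivial element of \<open>N\<close>: with \<open>M = 1\<close> in the last step,
  either \<open>x \<in> L\<close> centralises \<open>B\<close>, or \<open>\<langle>x\<rangle> \<inter> L = 1\<close> because \<open>x\<close> has order \<open>p\<close>, and then \<open>x\<close> fixes the
  indicator function of \<open>\<langle>x\<rangle>\<close> minus that of \<open>\<langle>x\<rangle>z\<close> for \<open>1 \<noteq> z \<in> L\<close>.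

  Every \<open>p\<close>-element of \<open>N \<rtimes> P\<close> is conjugate under \<open>N\<close> to some \<open>x \<in> P\<close>, as it has a fixed point on the
  \<open>p'\<close>-set \<open>N\<close>. Distinct elements of \<open>N\<close> give distinct conjugates of \<open>P\<close> since \<open>C\<^sub>N(P) = 1\<close>, so
  conjugating further by an element centralising \<open>x\<close> puts it in a second Sylow subgroup. Hence
  no single Sylow subgroup is needed.
\<close>

section \<open>Fitting series\<close>

lemma (in group) commutators_in_carrier:
  assumes "A \<subseteq> carrier G" "B \<subseteq> carrier G"
  shows "(\<Union>h\<in>A. \<Union>k\<in>B. {h \<otimes> k \<otimes> inv h \<otimes> inv k}) \<subseteq> carrier G"
  using assms by (auto simp: subset_iff)

lemma (in group) lower_central_subgroup: "subgroup (lower_central G i) G"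
proof (induction i)
  case (Suc i)
  then show ?case
    unfolding lower_central.simps commutator_subgroup_def
    by (intro generate_is_subgroup commutators_in_carrier) (auto dest: subgroup.mem_carrier)
qed (simp add: subgroup_self)

lemma (in group_hom) commutator_subgroup_img:
  assumes "A \<subseteq> carrier G" "B \<subseteq> carrier G"
  shows "commutator_subgroup H (h ` A) (h ` B) = h ` commutator_subgroup G A B"
proof -
  have "(\<Union>a\<in>h ` A. \<Union>b\<in>h ` B. {a \<otimes>\<^bsub>H\<^esub> b \<otimes>\<^bsub>H\<^esub> inv\<^bsub>H\<^esub> a \<otimes>\<^bsub>H\<^esub> inv\<^bsub>H\<^esub> b})
      = h ` (\<Union>a\<in>A. \<Union>b\<in>B. {a \<otimes> b \<otimes> inv a \<otimes> inv b})"
    using assms by (auto simp: image_UN subset_iff)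
  then show ?thesis
    using generate_img[OF G.commutators_in_carrier[OF assms]]
    by (simp add: commutator_subgroup_def)
qed

lemma (in group_hom) lower_central_img:
  assumes "h ` carrier G = carrier H"
  shows "lower_central H i = h ` lower_central G i"
proof (induction i)
  case (Suc i)
  then show ?case
    using commutator_subgroup_img[OF subgroup.subset[OF G.lower_central_subgroup[of i]], of "carrier G"]
    by (simp add: assms)
qed (simp add: assms)

lemma (in group_hom) nilpotent_img:
  assumes "h ` carrier G = carrier H" "nilpotent G"
  shows "nilpotent H"
proof -
  obtain n where "lower_central G n = {\<one>\<^bsub>G\<^esub>}"
    using assms(2) by (auto simp: nilpotent_def)
  then have "lower_central H n = {\<one>\<^bsub>H\<^esub>}"
    using lower_central_img[OF assms(1)] by simp
  then show ?thesis
    using H.group_axioms by (auto simp: nilpotent_def)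
qed

section \<open>Fitting subgroups and their preimages\<close>

lemma (in group) subset_fitting_subgroup:
  "K \<lhd> G \<Longrightarrow> nilpotent (G\<lparr>carrier := K\<rparr>) \<Longrightarrow> K \<subseteq> fitting_subgroup G"
  unfolding fitting_subgroup_def by (auto intro: generate.incl)

text \<open>Surjections preserve normality and nilpotency, and images commute with
  \<open>generate\<close>. The inclusion can be strict, as for the sign map on the symmetric group
  of degree 3; isomorphisms give equality by applying it in both directions.\<close>

lemma (in group_hom) img_fitting_subgroup_subset:
  assumes surj: "h ` carrier G = carrier H"
  shows "h ` fitting_subgroup G \<subseteq> fitting_subgroup H"
proof -
  let ?U = "\<Union>{K. K \<lhd> G \<and> nilpotent (G\<lparr>carrier := K\<rparr>)}"
  let ?W = "\<Union>{K. K \<lhd> H \<and> nilpotent (H\<lparr>carrier := K\<rparr>)}"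
  have U: "?U \<subseteq> carrier G"
    by (auto dest!: normal_imp_subgroup subgroup.subset)
  have "h ` ?U \<subseteq> ?W"
  proof clarify
    fix K x assume K: "K \<lhd> G" and nil: "nilpotent (G\<lparr>carrier := K\<rparr>)" and x: "x \<in> K"
    have nK: "h ` K \<lhd> H"
      using normal.surj_hom_normal_subgroup[OF K] group_hom_axioms surj by blast
    have "group_hom (G\<lparr>carrier := K\<rparr>) (H\<lparr>carrier := h ` K\<rparr>) h"
      using K nK subgroup.subset[OF normal_imp_subgroup[OF K]]
      by (auto intro!: group_hom.intro group_hom_axioms.intro homI
          intro: G.subgroup_imp_group H.subgroup_imp_group normal_imp_subgroup simp: subset_iff)
    then have "nilpotent (H\<lparr>carrier := h ` K\<rparr>)"
      using group_hom.nilpotent_img nil by fastforce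
    with nK x show "h x \<in> ?W" by blast
  qed
  then show ?thesis
    unfolding fitting_subgroup_def generate_img[OF U, symmetric] by (rule H.mono_generate)
qed

lemma fitting_subgroup_iso:
  assumes "group G" "group H" "h \<in> iso G H" "x \<in> carrier G"
  shows "h x \<in> fitting_subgroup H \<longleftrightarrow> x \<in> fitting_subgroup G"
proof -
  have hom: "group_hom G H h" and surj: "h ` carrier G = carrier H" and inj: "inj_on h (carrier G)"
    using assms by (auto simp: group_hom_def group_hom_axioms_def iso_iff)
  let ?g = "inv_into (carrier G) h"
  have "?g \<in> iso H G"
    using assms by (simp add: group.iso_set_sym)
  then have hom': "group_hom H G ?g" and surj': "?g ` carrier H = carrier G"
    using assms by (auto simp: group_hom_def group_hom_axioms_def iso_iff)
  have "?g (h x) = x"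
    using inj assms by simp
  then show ?thesis
    using group_hom.img_fitting_subgroup_subset[OF hom surj]
      group_hom.img_fitting_subgroup_subset[OF hom' surj'] by force
qed

lemma (in group) fitting_subgroup_normal: "fitting_subgroup G \<lhd> G"
  unfolding fitting_subgroup_def
proof (rule normal_generateI)
  show "\<Union>{H. H \<lhd> G \<and> nilpotent (G\<lparr>carrier := H\<rparr>)} \<subseteq> carrier G"
    by (auto dest!: normal_imp_subgroup subgroup.subset)
qed (auto intro: normal.inv_op_closed2)

lemma (in group_hom) normal_vimage:
  assumes "K \<lhd> H"
  shows "{x \<in> carrier G. h x \<in> K} \<lhd> G"
proof -
  interpret K: normal K H by fact
  show ?thesis
    by (auto simp: G.normal_inv_iff K.inv_op_closed2 intro!: G.subgroupI exI[of _ "\<one>\<^bsub>G\<^esub>"])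
qed

text \<open>The first isomorphism theorem replaces the union of cosets in
  \<open>fitting_series\<close> by a preimage along any surjection with the right kernel. Later
  arguments then never handle quotients of quotients.\<close>

lemma (in group_hom) Union_fitting_subgroup_Mod_kernel:
  assumes surj: "h ` carrier G = carrier H"
  shows "\<Union>(fitting_subgroup (G Mod kernel G H h)) = {x \<in> carrier G. h x \<in> fitting_subgroup H}"
proof -
  let ?K = "kernel G H h" and ?f = "\<lambda>C. the_elem (h ` C)"
  have Q: "group (G Mod ?K)"
    using normal.factorgroup_is_group[OF normal_kernel] .
  have val: "?f (?K #> x) = h x" if "x \<in> carrier G" for x
  proof -
    have "h y = h x" if "y \<in> ?K #> x" for y
      using that \<open>x \<in> carrier G\<close> by (auto simp: kernel_def r_coset_def)
    moreover have "x \<in> ?K #> x"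
      by (rule G.rcos_self[OF that subgroup_kernel])
    ultimately have "h ` (?K #> x) = {h x}"
      by blast
    then show ?thesis by simp
  qed
  have mem: "?K #> x \<in> carrier (G Mod ?K)" if "x \<in> carrier G" for x
    using that by (auto simp: FactGroup_def RCOSETS_def)
  have iff: "?K #> x \<in> fitting_subgroup (G Mod ?K) \<longleftrightarrow> h x \<in> fitting_subgroup H" if "x \<in> carrier G" for x
    using fitting_subgroup_iso[OF Q H.group_axioms FactGroup_iso_set[OF surj] mem[OF that]] val[OF that]
    by simp
  have sub: "fitting_subgroup (G Mod ?K) \<subseteq> carrier (G Mod ?K)"
    using group.fitting_subgroup_normal[OF Q] normal_imp_subgroup subgroup.subset by blast
  show ?thesis
  proof (intro equalityI subsetI)
    fix x assume "x \<in> \<Union>(fitting_subgroup (G Mod ?K))"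
    then obtain C where C: "C \<in> fitting_subgroup (G Mod ?K)" "x \<in> C" by blast
    with sub obtain a where a: "a \<in> carrier G" "C = ?K #> a"
      by (auto simp: FactGroup_def RCOSETS_def)
    then have "x \<in> carrier G" "C = ?K #> x"
      using C(2) G.r_coset_subset_G[OF subgroup.subset[OF subgroup_kernel]] G.repr_independence[OF _ _ subgroup_kernel]
      by blast+
    with C iff show "x \<in> {x \<in> carrier G. h x \<in> fitting_subgroup H}" by simp
  next
    fix x assume "x \<in> {x \<in> carrier G. h x \<in> fitting_subgroup H}"
    then show "x \<in> \<Union>(fitting_subgroup (G Mod ?K))"
      using iff G.rcos_self[OF _ subgroup_kernel] by blast
  qed
qed

lemma (in normal) group_hom_Mod: "group_hom G (G Mod H) (\<lambda>x. H #> x)"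
  by (simp add: group_hom_def group_hom_axioms_def r_coset_hom_Mod factorgroup_is_group is_group)

lemma (in normal) Mod_surj: "(\<lambda>x. H #> x) ` carrier G = carrier (G Mod H)"
  by (auto simp: FactGroup_def RCOSETS_def)

lemma (in normal) r_coset_eq_one_Mod_iff:
  "x \<in> carrier G \<Longrightarrow> H #> x = \<one>\<^bsub>G Mod H\<^esub> \<longleftrightarrow> x \<in> H"
  using coset_join1[OF _ _ subgroup_axioms] rcos_const[OF is_group] by (auto simp: FactGroup_def)

text \<open>The composite of \<open>h\<close> with the projection onto \<open>H Mod K\<close> is
  surjective with kernel \<open>fitting_series G j\<close>, so the preimage formula applies to
  it.\<close>

lemma fitting_series_Suc_vimage:
  assumes hom: "group_hom G H h" and surj: "h ` carrier G = carrier H"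
    and K: "K \<lhd> H" and eq: "fitting_series G j = {x \<in> carrier G. h x \<in> K}"
  shows "fitting_series G (Suc j) = {x \<in> carrier G. K #>\<^bsub>H\<^esub> h x \<in> fitting_subgroup (H Mod K)}"
proof -
  interpret h: group_hom G H h by fact
  interpret K: normal K H by fact
  have comp: "group_hom G (H Mod K) (\<lambda>x. K #>\<^bsub>H\<^esub> h x)"
    using h.homh hom_compose[OF h.homh K.r_coset_hom_Mod]
    by (simp add: group_hom_def group_hom_axioms_def K.factorgroup_is_group comp_def)
  have "(\<lambda>x. K #>\<^bsub>H\<^esub> h x) ` carrier G = (\<lambda>x. K #>\<^bsub>H\<^esub> x) ` (h ` carrier G)" by blast
  then have "(\<lambda>x. K #>\<^bsub>H\<^esub> h x) ` carrier G = carrier (H Mod K)"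
    by (simp add: surj K.Mod_surj)
  moreover have "kernel G (H Mod K) (\<lambda>x. K #>\<^bsub>H\<^esub> h x) = fitting_series G j"
    using K.r_coset_eq_one_Mod_iff[OF h.hom_closed] by (simp add: kernel_def eq cong: conj_cong del: one_FactGroup)
  ultimately show ?thesis
    using group_hom.Union_fitting_subgroup_Mod_kernel[OF comp] by simp
qed

lemma (in group) group_hom_id: "group_hom G G (\<lambda>x. x)"
  by (simp add: group_hom_def group_hom_axioms_def hom_def)

lemma (in group) fitting_series_normal: "fitting_series G i \<lhd> G"
proof (induction i)
  case 0
  then show ?case by (simp add: one_is_normal)
next
  case (Suc i)
  interpret F: normal "fitting_series G i" G by fact
  have "fitting_series G (Suc i)
      = {x \<in> carrier G. fitting_series G i #> x \<in> fitting_subgroup (G Mod fitting_series G i)}"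
    using F.subset by (intro fitting_series_Suc_vimage[OF group_hom_id _ Suc]) auto
  then show ?case
    using group_hom.normal_vimage[OF F.group_hom_Mod
        group.fitting_subgroup_normal[OF F.factorgroup_is_group]] by simp
qed

text \<open>Factoring out the \<open>j\<close>-th term shifts the series by \<open>j\<close>. The
  case \<open>j = 0\<close> gives invariance under isomorphism, the case \<open>j = 1\<close> the
  height step.\<close>

lemma fitting_series_vimage:
  assumes hom: "group_hom G H h" and surj: "h ` carrier G = carrier H"
    and eq: "fitting_series G j = kernel G H h"
  shows "fitting_series G (i + j) = {x \<in> carrier G. h x \<in> fitting_series H i}"
proof (induction i)
  case 0
  then show ?case by (auto simp: eq kernel_def)
next
  case (Suc i)
  interpret h: group_hom G H h by fact
  have n: "fitting_series H i \<lhd> H" by (rule h.H.fitting_series_normal)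
  have "fitting_series H (Suc i)
      = {x \<in> carrier H. fitting_series H i #>\<^bsub>H\<^esub> x \<in> fitting_subgroup (H Mod fitting_series H i)}"
    using normal.axioms(1)[OF n, THEN subgroup.subset]
    by (intro fitting_series_Suc_vimage[OF h.H.group_hom_id _ n]) auto
  then show ?case
    using fitting_series_Suc_vimage[OF hom surj n Suc] by auto
qed

lemma (in group) fitting_series_1: "fitting_series G (Suc 0) = fitting_subgroup G"
proof -
  have "fitting_subgroup G \<subseteq> carrier G"
    using fitting_subgroup_normal normal_imp_subgroup subgroup.subset by blast
  moreover have "kernel G G (\<lambda>x. x) = {\<one>}" by (auto simp: kernel_def)
  ultimately show ?thesis
    using group_hom.Union_fitting_subgroup_Mod_kernel[OF group_hom_id] by auto
qed

text \<open>Unlike the \<open>LEAST\<close> in \<open>fitting_height\<close>, this also asserts that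
  the series does reach the whole group, which is what the induction has to carry.\<close>

definition has_fitting_height :: "('a, 'b) monoid_scheme \<Rightarrow> nat \<Rightarrow> bool" where
  "has_fitting_height G n \<longleftrightarrow>
     fitting_series G n = carrier G \<and> (\<forall>m<n. fitting_series G m \<noteq> carrier G)"

lemma has_fitting_height_imp_eq: "has_fitting_height G n \<Longrightarrow> fitting_height G = n"
  unfolding has_fitting_height_def fitting_height_def
  by (intro Least_equality) (blast, meson not_less)

lemma fitting_series_eq_carrier_vimage:
  assumes "group_hom G H h" "h ` carrier G = carrier H" "fitting_series G j = kernel G H h"
  shows "fitting_series G (i + j) = carrier G \<longleftrightarrow> fitting_series H i = carrier H"
proof -
  interpret h: group_hom G H h by fact
  have "fitting_series H i \<subseteq> carrier H"
    using h.H.fitting_series_normal normal_imp_subgroup subgroup.subset by blast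
  then have "fitting_series H i = carrier H \<longleftrightarrow> (\<forall>x\<in>carrier G. h x \<in> fitting_series H i)"
    unfolding assms(2)[symmetric] by blast
  also have "\<dots> \<longleftrightarrow> fitting_series G (i + j) = carrier G"
    unfolding fitting_series_vimage[OF assms, of i] by blast
  finally show ?thesis by blast
qed

lemma has_fitting_height_iso:
  assumes "group G" "group H" "h \<in> iso G H" "has_fitting_height G n"
  shows "has_fitting_height H n"
proof -
  have "group_hom G H h" "h ` carrier G = carrier H" "fitting_series G 0 = kernel G H h"
    using assms iso_kernel_image[of G H h] by (auto simp: group_hom_def group_hom_axioms_def)
  from fitting_series_eq_carrier_vimage[OF this] show ?thesis
    using assms(4) by (simp add: has_fitting_height_def)
qed

text \<open>The series of \<open>H\<close> is that of \<open>G\<close> without its first term. Stage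
  0 of \<open>G\<close> is not covered by this shift and is excluded by nontriviality.\<close>

lemma has_fitting_height_Suc:
  assumes "group_hom G H h" "h ` carrier G = carrier H" "fitting_subgroup G = kernel G H h"
    and "carrier G \<noteq> {\<one>\<^bsub>G\<^esub>}" "has_fitting_height H n"
  shows "has_fitting_height G (Suc n)"
proof -
  have "fitting_series G (Suc 0) = kernel G H h"
    using group.fitting_series_1[OF group_hom.axioms(1)[OF assms(1)]] assms(3)
    by (simp del: fitting_series.simps)
  from fitting_series_eq_carrier_vimage[OF assms(1,2) this]
  have eq: "fitting_series G (Suc i) = carrier G \<longleftrightarrow> fitting_series H i = carrier H" for i
    by (simp del: fitting_series.simps)
  have "fitting_series G m \<noteq> carrier G" if "m < Suc n" for m
    using that eq assms(4,5) by (cases m) (auto simp: has_fitting_height_def simp del: fitting_series.simps(2))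
  then show ?thesis
    using eq assms(5) by (simp add: has_fitting_height_def del: fitting_series.simps(2))
qed

section \<open>Fixed points of prime power groups\<close>

text \<open>Elements of \<open>Bij E\<close> are extensional functions, hence the
  \<open>restrict\<close>; bijectivity comes from the inverse group element.\<close>

lemma group_actionI:
  assumes "group G"
    and closed: "\<And>g x. g \<in> carrier G \<Longrightarrow> x \<in> E \<Longrightarrow> \<phi> g x \<in> E"
    and one: "\<And>x. x \<in> E \<Longrightarrow> \<phi> \<one>\<^bsub>G\<^esub> x = x"
    and mult: "\<And>g h x. g \<in> carrier G \<Longrightarrow> h \<in> carrier G \<Longrightarrow> x \<in> E \<Longrightarrow> \<phi> (g \<otimes>\<^bsub>G\<^esub> h) x = \<phi> g (\<phi> h x)"
  shows "group_action G E (\<lambda>g. restrict (\<phi> g) E)"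
proof -
  interpret G: group G by fact
  have Bij: "restrict (\<phi> g) E \<in> Bij E" if "g \<in> carrier G" for g
  proof -
    have "bij_betw (\<phi> g) E E"
      by (rule bij_betw_byWitness[where f' = "\<phi> (inv\<^bsub>G\<^esub> g)"])
        (use that closed in \<open>auto simp: mult[symmetric] one\<close>)
    then show ?thesis by (simp add: Bij_def)
  qed
  then have "(\<lambda>g. restrict (\<phi> g) E) \<in> hom G (BijGroup E)"
    by (auto simp: hom_def BijGroup_def compose_def closed mult restrict_def)
  then show ?thesis
    by (simp add: group_action_def group_hom_def group_hom_axioms_def group_BijGroup G.group_axioms)
qed

text \<open>Orbit sizes divide a power of \<open>p\<close>, so every orbit is a single fixed point
  or has size divisible by \<open>p\<close>.\<close>

lemma (in group_action) card_mod_prime_eq_fixed: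
  assumes p: "Factorial_Ring.prime p" and ord: "order G = p ^ k" and fin: "finite E"
  shows "card E mod p = card {x \<in> E. \<forall>g\<in>carrier G. \<phi> g x = x} mod p"
proof -
  let ?F = "{x \<in> E. \<forall>g\<in>carrier G. \<phi> g x = x}"
  let ?O = "orbits G E \<phi>"
  have finO: "finite ?O"
    using fin by (simp add: orbits_def setcompr_eq_image)
  have orbit_card: "card orb = 1 \<or> p dvd card orb" if orb: "orb \<in> ?O" for orb
  proof -
    obtain x where "x \<in> E" "orb = orbit G \<phi> x"
      using orb by (auto simp: orbits_def)
    then have "card orb dvd p ^ k"
      using orbit_stabilizer_theorem ord by (metis dvd_triv_left)
    then obtain i where "card orb = p ^ i"
      using divides_primepow_nat[OF p] by blast
    then show ?thesis by (cases i) auto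
  qed
  have orbit_fixed: "orbit G \<phi> x = {x}" if "x \<in> ?F" for x
    using that orbit_refl[of x] by (auto simp: orbit_def)
  have "{orb \<in> ?O. card orb = 1} = (\<lambda>x. {x}) ` ?F"
  proof (intro equalityI subsetI)
    fix orb assume "orb \<in> {orb \<in> ?O. card orb = 1}"
    then obtain x where x: "x \<in> E" "orb = orbit G \<phi> x" "card orb = 1"
      by (auto simp: orbits_def)
    then have "orb = {x}"
      using orbit_refl[of x] by (metis card_1_singletonE singletonD)
    with x show "orb \<in> (\<lambda>x. {x}) ` ?F"
      by (auto simp: orbit_def)
  next
    fix orb assume "orb \<in> (\<lambda>x. {x}) ` ?F"
    then obtain x where "x \<in> ?F" "orb = {x}" by blast
    with orbit_fixed[of x] show "orb \<in> {orb \<in> ?O. card orb = 1}"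
      by (auto simp: orbits_def)
  qed
  then have "card {orb \<in> ?O. card orb = 1} = card ?F"
    by (simp add: card_image)
  moreover have "card E = (\<Sum>orb\<in>?O. card orb)"
    using disjoint_sum[OF fin, of "\<lambda>_. 1::nat"] by simp
  moreover have "(\<Sum>orb\<in>?O. card orb)
      = (\<Sum>orb\<in>{orb \<in> ?O. card orb = 1}. card orb) + (\<Sum>orb\<in>{orb \<in> ?O. card orb \<noteq> 1}. card orb)"
    by (subst sum.union_disjoint[symmetric]) (use finO in \<open>auto intro!: sum.cong\<close>)
  moreover have "p dvd (\<Sum>orb\<in>{orb \<in> ?O. card orb \<noteq> 1}. card orb)"
    using orbit_card by (intro dvd_sum) blast
  ultimately show ?thesis
    by (auto elim!: dvdE)
qed

text \<open>Under conjugation the fixed points form the centre. Their number is divisible by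
  \<open>p\<close>, and the identity is one of them, so there is another.\<close>

lemma (in group) ex_central_if_prime_power_order:
  assumes p: "Factorial_Ring.prime p" and ord: "order G = p ^ Suc k"
  shows "\<exists>z\<in>carrier G. z \<noteq> \<one> \<and> (\<forall>g\<in>carrier G. g \<otimes> z \<otimes> inv g = z)"
proof -
  have fin: "finite (carrier G)"
    using p ord by (simp add: order_gt_0_iff_finite[symmetric] prime_gt_0_nat)
  interpret conj: group_action G "carrier G" "\<lambda>g. \<lambda>h \<in> carrier G. g \<otimes> h \<otimes> inv g"
    by (rule action_by_conjugation)
  let ?Z = "{z \<in> carrier G. \<forall>g\<in>carrier G. (\<lambda>h \<in> carrier G. g \<otimes> h \<otimes> inv g) z = z}"
  have "card ?Z mod p = 0"
    using conj.card_mod_prime_eq_fixed[OF p ord fin] ord by (simp add: order_def)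
  then have "card ?Z \<noteq> 1"
    using prime_gt_1_nat[OF p] by (metis mod_less one_neq_zero)
  moreover have "\<one> \<in> ?Z" by simp
  ultimately obtain z where "z \<in> ?Z" "z \<noteq> \<one>"
    by (metis (lifting) card_1_singleton_iff is_singletonI' is_singleton_altdef empty_iff)
  then show ?thesis by auto
qed

text \<open>A nontrivial central element of the \<open>p\<close>-group \<open>G Mod M\<close> has
  order \<open>p\<close> because of the exponent, and generates a normal subgroup \<open>C\<close>.
  Its preimage is the next term of a chief series.\<close>

lemma (in group) ex_normal_extension_of_prime_index:
  assumes p: "Factorial_Ring.prime p" and exponent: "\<And>x. x \<in> carrier G \<Longrightarrow> x [^] p = \<one>"
    and ord: "order G = p ^ Suc k * card M" and pos: "0 < order G" and M: "M \<lhd> G"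
  shows "\<exists>L. L \<lhd> G \<and> M \<subseteq> L \<and> card L = p * card M"
proof -
  interpret M: normal M G by fact
  interpret Q: group "G Mod M" by (rule M.factorgroup_is_group)
  interpret q: group_hom G "G Mod M" "\<lambda>x. M #> x" by (rule M.group_hom_Mod)
  have fin: "finite (carrier G)" using pos by (simp add: order_gt_0_iff_finite)
  have "card (rcosets M) * card M = p ^ Suc k * card M" "card M \<noteq> 0"
    using lagrange[OF M.subgroup_axioms] ord pos by auto
  then have "order (G Mod M) = p ^ Suc k"
    by (simp add: order_def FactGroup_def)
  from Q.ex_central_if_prime_power_order[OF p this]
  obtain z where z: "z \<in> carrier (G Mod M)" "z \<noteq> \<one>\<^bsub>G Mod M\<^esub>"
    and central: "\<And>g. g \<in> carrier (G Mod M) \<Longrightarrow> g \<otimes>\<^bsub>G Mod M\<^esub> z \<otimes>\<^bsub>G Mod M\<^esub> inv\<^bsub>G Mod M\<^esub> g = z"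
    by blast
  obtain x where x: "x \<in> carrier G" "z = M #> x"
    using z(1) by (auto simp: FactGroup_def RCOSETS_def)
  have "z [^]\<^bsub>G Mod M\<^esub> p = M #> (x [^] p)"
    using q.hom_nat_pow[OF x(1), of p] x(2) by simp
  also have "\<dots> = \<one>\<^bsub>G Mod M\<^esub>"
    using exponent[OF x(1)] q.hom_one by simp
  finally have "Q.ord z dvd p" using Q.pow_eq_id[OF z(1)] by blast
  moreover have "Q.ord z \<noteq> 1" using Q.ord_eq_1[OF z(1)] z(2) by blast
  ultimately have ordz: "Q.ord z = p" using p by (meson prime_nat_iff)
  define C where "C = generate (G Mod M) {z}"
  have CQ: "C \<lhd> G Mod M"
    unfolding C_def using z central by (intro Q.normal_generateI) auto
  have Csub: "C \<subseteq> rcosets M"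
    using normal_imp_subgroup[OF CQ] subgroup.subset by (fastforce simp: FactGroup_def)
  have cardC: "card C = p"
    using Q.generate_pow_card[OF z(1)] ordz by (simp add: C_def)
  have "subgroup C (G Mod M)" using CQ by (rule normal_imp_subgroup)
  then have oneC: "M \<in> C" using subgroup.one_closed by fastforce
  have "{x \<in> carrier G. M #> x \<in> C} = \<Union>C"
  proof (intro equalityI subsetI)
    fix y assume "y \<in> \<Union>C"
    then obtain R where R: "R \<in> C" "y \<in> R" by blast
    then obtain a where a: "a \<in> carrier G" "R = M #> a"
      using Csub by (auto simp: RCOSETS_def)
    have "y \<in> carrier G" using a R(2) r_coset_subset_G[OF M.subset] by blast
    moreover have "R = M #> y"
      using repr_independence[OF _ a(1) M.subgroup_axioms] R(2) a(2) by simp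
    ultimately show "y \<in> {x \<in> carrier G. M #> x \<in> C}" using R(1) by simp
  qed (use rcos_self[OF _ M.subgroup_axioms] in blast)
  moreover have "card M * card C = card (\<Union>C)"
  proof (rule card_partition)
    show "finite (\<Union>C)"
      using Csub rcosets_part_G[OF M.subgroup_axioms] fin by (metis Sup_subset_mono finite_subset)
    then show "finite C" by (rule finite_UnionD)
    show "card c = card M" if "c \<in> C" for c
      using that Csub card_rcosets_equal[OF _ M.subset] by auto
    show "c1 \<inter> c2 = {}" if "c1 \<in> C" "c2 \<in> C" "c1 \<noteq> c2" for c1 c2
      using that Csub pairwiseD[OF rcos_disjoint[OF M.subgroup_axioms]] unfolding disjnt_def by blast
  qed
  moreover have "M \<subseteq> \<Union>C" using oneC by blast
  ultimately show ?thesis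
    using q.normal_vimage[OF CQ] cardC by (intro exI[of _ "\<Union>C"]) (simp add: mult.commute)
qed

section \<open>Semidirect products\<close>

lemma (in comm_group) nilpotent: "nilpotent G"
proof -
  have "h \<otimes> k \<otimes> inv h \<otimes> inv k = \<one>" if "h \<in> carrier G" "k \<in> carrier G" for h k
    using that by (metis inv_mult m_assoc m_closed inv_closed r_inv m_comm)
  then have "(\<Union>h\<in>carrier G. \<Union>k\<in>carrier G. {h \<otimes> k \<otimes> inv h \<otimes> inv k}) = {\<one>}"
    by auto
  then have "lower_central G (Suc 0) = {\<one>}"
    by (simp add: commutator_subgroup_def generate_one)
  then show ?thesis
    unfolding nilpotent_def using is_group by blast
qed

text \<open>The maps are constrained only on the carrier, so constructed actions need no
  \<open>restrict\<close>; the passage to the extensional maps of \<open>AutoGroup\<close> is made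
  separately.\<close>

locale aut_action = N: group N + P: group P
  for N :: "('b, 'd) monoid_scheme" and P :: "('a, 'c) monoid_scheme"
    and \<phi> :: "'a \<Rightarrow> 'b \<Rightarrow> 'b" +
  assumes act_closed [simp]: "x \<in> carrier P \<Longrightarrow> a \<in> carrier N \<Longrightarrow> \<phi> x a \<in> carrier N"
    and act_mult: "x \<in> carrier P \<Longrightarrow> a \<in> carrier N \<Longrightarrow> b \<in> carrier N \<Longrightarrow>
      \<phi> x (a \<otimes>\<^bsub>N\<^esub> b) = \<phi> x a \<otimes>\<^bsub>N\<^esub> \<phi> x b"
    and act_comp: "x \<in> carrier P \<Longrightarrow> y \<in> carrier P \<Longrightarrow> a \<in> carrier N \<Longrightarrow>
      \<phi> (x \<otimes>\<^bsub>P\<^esub> y) a = \<phi> x (\<phi> y a)"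
    and act_one [simp]: "a \<in> carrier N \<Longrightarrow> \<phi> \<one>\<^bsub>P\<^esub> a = a"
begin

lemma act_fixes_one [simp]: "x \<in> carrier P \<Longrightarrow> \<phi> x \<one>\<^bsub>N\<^esub> = \<one>\<^bsub>N\<^esub>"
  using act_mult[of x "\<one>\<^bsub>N\<^esub>" "\<one>\<^bsub>N\<^esub>"] N.l_cancel_one'[of "\<phi> x \<one>\<^bsub>N\<^esub>" "\<phi> x \<one>\<^bsub>N\<^esub>"] by simp

lemma act_inv: "x \<in> carrier P \<Longrightarrow> a \<in> carrier N \<Longrightarrow> \<phi> x (inv\<^bsub>N\<^esub> a) = inv\<^bsub>N\<^esub> (\<phi> x a)"
  by (rule N.inv_equality[symmetric]) (simp_all add: act_mult[symmetric])

lemma act_inv_act [simp]: "x \<in> carrier P \<Longrightarrow> a \<in> carrier N \<Longrightarrow> \<phi> (inv\<^bsub>P\<^esub> x) (\<phi> x a) = a"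
  by (simp add: act_comp[symmetric])

lemma act_act_inv [simp]: "x \<in> carrier P \<Longrightarrow> a \<in> carrier N \<Longrightarrow> \<phi> x (\<phi> (inv\<^bsub>P\<^esub> x) a) = a"
  by (simp add: act_comp[symmetric])

lemma group_action_act: "group_action P (carrier N) (\<lambda>x. restrict (\<phi> x) (carrier N))"
  by (rule group_actionI) (auto simp: act_comp P.group_axioms)

lemma restrict_act_hom_AutoGroup: "(\<lambda>x. restrict (\<phi> x) (carrier N)) \<in> hom P (AutoGroup N)"
proof -
  have "(\<lambda>x. restrict (\<phi> x) (carrier N)) \<in> hom P (BijGroup (carrier N))"
    using group_action_act by (simp add: group_action_def group_hom.homh)
  moreover have "restrict (\<phi> x) (carrier N) \<in> hom N N" if "x \<in> carrier P" for x
    using that by (auto simp: hom_def act_mult)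
  ultimately show ?thesis
    by (auto simp: hom_def AutoGroup_def auto_def BijGroup_def)
qed

abbreviation (input) S where "S \<equiv> semidirect_product N P \<phi>"

lemma carrier_semidirect: "carrier S = carrier N \<times> carrier P"
  by (simp add: semidirect_product_def)

lemma mult_semidirect [simp]: "(a, x) \<otimes>\<^bsub>S\<^esub> (b, y) = (a \<otimes>\<^bsub>N\<^esub> \<phi> x b, x \<otimes>\<^bsub>P\<^esub> y)"
  by (simp add: semidirect_product_def)

lemma one_semidirect: "\<one>\<^bsub>S\<^esub> = (\<one>\<^bsub>N\<^esub>, \<one>\<^bsub>P\<^esub>)"
  by (simp add: semidirect_product_def)

lemma order_semidirect: "order S = order N * order P"
  by (simp add: order_def carrier_semidirect card_cartesian_product)

lemma group_semidirect: "group S"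
proof (rule groupI)
  show "\<one>\<^bsub>S\<^esub> \<in> carrier S" by (simp add: carrier_semidirect one_semidirect)
next
  fix g assume "g \<in> carrier S"
  then show "\<exists>h\<in>carrier S. h \<otimes>\<^bsub>S\<^esub> g = \<one>\<^bsub>S\<^esub>"
    by (cases g, intro bexI[of _ "(\<phi> (inv\<^bsub>P\<^esub> (snd g)) (inv\<^bsub>N\<^esub> (fst g)), inv\<^bsub>P\<^esub> (snd g))"])
      (auto simp: carrier_semidirect one_semidirect act_mult[symmetric])
qed (auto simp: carrier_semidirect one_semidirect N.m_assoc P.m_assoc act_mult act_comp)

lemma inv_semidirect:
  assumes "a \<in> carrier N" "x \<in> carrier P"
  shows "inv\<^bsub>S\<^esub> (a, x) = (\<phi> (inv\<^bsub>P\<^esub> x) (inv\<^bsub>N\<^esub> a), inv\<^bsub>P\<^esub> x)"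
  by (rule group.inv_equality[OF group_semidirect])
    (use assms in \<open>auto simp: carrier_semidirect one_semidirect act_mult[symmetric]\<close>)

lemma group_hom_snd: "group_hom S P snd"
  by (auto simp: group_hom_def group_hom_axioms_def group_semidirect P.group_axioms carrier_semidirect hom_def)

lemma snd_surj: "snd ` carrier S = carrier P"
  by (force simp: carrier_semidirect)

lemma kernel_snd: "kernel S P snd = carrier N \<times> {\<one>\<^bsub>P\<^esub>}"
  by (auto simp: kernel_def carrier_semidirect)

lemma group_hom_base: "group_hom N S (\<lambda>a. (a, \<one>\<^bsub>P\<^esub>))"
  by (auto simp: group_hom_def group_hom_axioms_def group_semidirect N.group_axioms carrier_semidirect hom_def)

lemma solvable_semidirect:
  assumes "solvable N" "solvable P"
  shows "solvable S"
  by (rule solvable_condition[OF group_hom_base group_hom_snd snd_surj _ assms])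
    (auto simp: kernel_snd)

text \<open>In additive notation \<open>e = (m - 1) u\<close> is fixed by \<open>m\<close>, so
  \<open>m^j u = u + j e\<close>. At \<open>j = order P\<close> the left side is \<open>u\<close>,
  hence \<open>order P\<close> kills \<open>e\<close>, and \<open>tors\<close> gives
  \<open>e = 0\<close>.\<close>

lemma act_eq_if_quadratic:
  assumes comm: "comm_group N"
    and tors: "\<And>u. u \<in> carrier N \<Longrightarrow> u [^]\<^bsub>N\<^esub> order P = \<one>\<^bsub>N\<^esub> \<Longrightarrow> u = \<one>\<^bsub>N\<^esub>"
    and m: "m \<in> carrier P" and u: "u \<in> carrier N"
    and quad: "\<phi> m (\<phi> m u \<otimes>\<^bsub>N\<^esub> inv\<^bsub>N\<^esub> u) = \<phi> m u \<otimes>\<^bsub>N\<^esub> inv\<^bsub>N\<^esub> u"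
  shows "\<phi> m u = u"
proof -
  interpret N': comm_group N by fact
  define e where "e = \<phi> m u \<otimes>\<^bsub>N\<^esub> inv\<^bsub>N\<^esub> u"
  have e: "e \<in> carrier N" "\<phi> m e = e" "\<phi> m u = e \<otimes>\<^bsub>N\<^esub> u"
    using quad m u by (auto simp: e_def N.m_assoc)
  have pow_e: "\<phi> m (e [^]\<^bsub>N\<^esub> j) = e [^]\<^bsub>N\<^esub> j" for j :: nat
    by (induction j) (auto simp: e m act_mult)
  have "\<phi> (m [^]\<^bsub>P\<^esub> j) u = e [^]\<^bsub>N\<^esub> j \<otimes>\<^bsub>N\<^esub> u" for j :: nat
  proof (induction j)
    case (Suc j)
    have "\<phi> (m [^]\<^bsub>P\<^esub> Suc j) u = \<phi> m (\<phi> (m [^]\<^bsub>P\<^esub> j) u)"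
      unfolding P.nat_pow_Suc2[OF m] using m u by (simp add: act_comp)
    also have "\<dots> = e [^]\<^bsub>N\<^esub> j \<otimes>\<^bsub>N\<^esub> (e \<otimes>\<^bsub>N\<^esub> u)"
      using m u e by (simp add: Suc act_mult pow_e)
    finally show ?case
      using e u by (simp add: N.m_assoc)
  qed (use u in auto)
  from this[of "order P"] have "u = e [^]\<^bsub>N\<^esub> order P \<otimes>\<^bsub>N\<^esub> u"
    using m u by (simp add: P.pow_order_eq_1)
  then have "e [^]\<^bsub>N\<^esub> order P = \<one>\<^bsub>N\<^esub>"
    using e u by (metis N.l_one N.nat_pow_closed N.one_closed N.right_cancel)
  with tors e have "e = \<one>\<^bsub>N\<^esub>" by blast
  with e u show ?thesis by simp
qed

text \<open>If \<open>(v, m)\<close> lies in a nilpotent normal subgroup, then iterated commutators with it kill the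
  base, so \<open>(m - 1)\<^sup>c\<close> vanishes on the base; coprimality improves this to \<open>m - 1 = 0\<close>.\<close>

lemma nilpotent_normal_subset_base:
  assumes comm: "comm_group N"
    and tors: "\<And>u. u \<in> carrier N \<Longrightarrow> u [^]\<^bsub>N\<^esub> order P = \<one>\<^bsub>N\<^esub> \<Longrightarrow> u = \<one>\<^bsub>N\<^esub>"
    and faithful: "\<And>m. m \<in> carrier P \<Longrightarrow> (\<And>w. w \<in> carrier N \<Longrightarrow> \<phi> m w = w) \<Longrightarrow> m = \<one>\<^bsub>P\<^esub>"
    and K: "K \<lhd> S" and nil: "nilpotent (S\<lparr>carrier := K\<rparr>)"
  shows "K \<subseteq> carrier N \<times> {\<one>\<^bsub>P\<^esub>}"
proof
  interpret N': comm_group N by fact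
  interpret S: group S by (rule group_semidirect)
  have subK: "subgroup K S" using K by (rule normal_imp_subgroup)
  let ?K = "S\<lparr>carrier := K\<rparr>"
  interpret K': group ?K using subK by (rule S.subgroup_imp_group)
  fix k assume kK: "k \<in> K"
  obtain v m where k: "k = (v, m)" by (cases k)
  have v: "v \<in> carrier N" and m: "m \<in> carrier P"
    using kK k subgroup.mem_carrier[OF subK] by (auto simp: carrier_semidirect)
  \<comment> \<open>\<open>D\<close> is the operator \<open>m - 1\<close>. Since the base is
    abelian, \<open>v\<close> drops out of the commutator of \<open>k\<close> with a base
    element.\<close>
  define D where "D w = \<phi> m w \<otimes>\<^bsub>N\<^esub> inv\<^bsub>N\<^esub> w" for w
  have D: "D w \<in> carrier N" if "w \<in> carrier N" for w
    using that m by (simp add: D_def)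
  have Dpow: "(D ^^ i) w \<in> carrier N" if "w \<in> carrier N" for i w
    using that by (induction i) (auto simp: D)
  have conj: "k \<otimes>\<^bsub>S\<^esub> (w, \<one>\<^bsub>P\<^esub>) \<otimes>\<^bsub>S\<^esub> inv\<^bsub>S\<^esub> k \<otimes>\<^bsub>S\<^esub> inv\<^bsub>S\<^esub> (w, \<one>\<^bsub>P\<^esub>) = (D w, \<one>\<^bsub>P\<^esub>)"
    if "w \<in> carrier N" for w
  proof -
    have "v \<otimes>\<^bsub>N\<^esub> \<phi> m w \<otimes>\<^bsub>N\<^esub> inv\<^bsub>N\<^esub> v = \<phi> m w"
      using that v m by (simp add: N'.m_comm[of v] N.m_assoc)
    then show ?thesis
      using that v m by (simp add: k inv_semidirect D_def)
  qed
  \<comment> \<open>\<open>lower_central\<close> puts the element of the previous term on the left,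
    so the commutators that occur there are the inverses of those in \<open>conj\<close>.\<close>
  have inv_D: "(w, \<one>\<^bsub>P\<^esub>) \<otimes>\<^bsub>S\<^esub> k \<otimes>\<^bsub>S\<^esub> inv\<^bsub>S\<^esub> (w, \<one>\<^bsub>P\<^esub>) \<otimes>\<^bsub>S\<^esub> inv\<^bsub>S\<^esub> k = inv\<^bsub>S\<^esub> (D w, \<one>\<^bsub>P\<^esub>)"
    if "w \<in> carrier N" for w
  proof -
    have "a \<otimes>\<^bsub>S\<^esub> k \<otimes>\<^bsub>S\<^esub> inv\<^bsub>S\<^esub> a \<otimes>\<^bsub>S\<^esub> inv\<^bsub>S\<^esub> k = inv\<^bsub>S\<^esub> (k \<otimes>\<^bsub>S\<^esub> a \<otimes>\<^bsub>S\<^esub> inv\<^bsub>S\<^esub> k \<otimes>\<^bsub>S\<^esub> inv\<^bsub>S\<^esub> a)"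
      if "a \<in> carrier S" for a
      using that subgroup.mem_carrier[OF subK kK] by (simp add: S.inv_mult_group S.m_assoc)
    then show ?thesis
      using that unfolding conj[OF that, symmetric] by (simp add: carrier_semidirect)
  qed
  \<comment> \<open>The exponent is one ahead of the index: a base element \<open>(w, 1)\<close>
    need not lie in \<open>K\<close>, but its commutator with \<open>k\<close> does, by
    normality.\<close>
  have lc: "((D ^^ Suc i) w, \<one>\<^bsub>P\<^esub>) \<in> lower_central ?K i" if w: "w \<in> carrier N" for i w
  proof (induction i)
    case 0
    have "(w, \<one>\<^bsub>P\<^esub>) \<in> carrier S" using w by (simp add: carrier_semidirect)
    then have "(w, \<one>\<^bsub>P\<^esub>) \<otimes>\<^bsub>S\<^esub> inv\<^bsub>S\<^esub> k \<otimes>\<^bsub>S\<^esub> inv\<^bsub>S\<^esub> (w, \<one>\<^bsub>P\<^esub>) \<in> K"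
      using normal.inv_op_closed2[OF K] subgroup.m_inv_closed[OF subK kK] by blast
    then have "k \<otimes>\<^bsub>S\<^esub> ((w, \<one>\<^bsub>P\<^esub>) \<otimes>\<^bsub>S\<^esub> inv\<^bsub>S\<^esub> k \<otimes>\<^bsub>S\<^esub> inv\<^bsub>S\<^esub> (w, \<one>\<^bsub>P\<^esub>)) \<in> K"
      using subgroup.m_closed[OF subK kK] by blast
    also have "k \<otimes>\<^bsub>S\<^esub> ((w, \<one>\<^bsub>P\<^esub>) \<otimes>\<^bsub>S\<^esub> inv\<^bsub>S\<^esub> k \<otimes>\<^bsub>S\<^esub> inv\<^bsub>S\<^esub> (w, \<one>\<^bsub>P\<^esub>)) = (D w, \<one>\<^bsub>P\<^esub>)"
      unfolding conj[OF w, symmetric]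
      using \<open>(w, \<one>\<^bsub>P\<^esub>) \<in> carrier S\<close> subgroup.mem_carrier[OF subK kK] by (simp add: S.m_assoc)
    finally show ?case by simp
  next
    case (Suc i)
    let ?d = "(D ^^ Suc i) w"
    have d: "?d \<in> carrier N" using Dpow[OF w] .
    have LK: "lower_central ?K i \<subseteq> K"
      using subgroup.subset[OF K'.lower_central_subgroup] by simp
    have "(?d, \<one>\<^bsub>P\<^esub>) \<otimes>\<^bsub>?K\<^esub> k \<otimes>\<^bsub>?K\<^esub> inv\<^bsub>?K\<^esub> (?d, \<one>\<^bsub>P\<^esub>) \<otimes>\<^bsub>?K\<^esub> inv\<^bsub>?K\<^esub> k \<in> lower_central ?K (Suc i)"
      unfolding lower_central.simps commutator_subgroup_def
      using Suc kK by (intro generate.incl) auto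
    moreover have "inv\<^bsub>?K\<^esub> (?d, \<one>\<^bsub>P\<^esub>) = inv\<^bsub>S\<^esub> (?d, \<one>\<^bsub>P\<^esub>)" "inv\<^bsub>?K\<^esub> k = inv\<^bsub>S\<^esub> k"
      using S.m_inv_consistent[OF subK] Suc LK kK by blast+
    ultimately have mem: "inv\<^bsub>S\<^esub> (D ?d, \<one>\<^bsub>P\<^esub>) \<in> lower_central ?K (Suc i)"
      using inv_D[OF d] by simp
    then have "inv\<^bsub>S\<^esub> (D ?d, \<one>\<^bsub>P\<^esub>) \<in> K"
      using subgroup.subset[OF K'.lower_central_subgroup[of "Suc i"]] by auto
    then have "inv\<^bsub>?K\<^esub> (inv\<^bsub>S\<^esub> (D ?d, \<one>\<^bsub>P\<^esub>)) = (D ?d, \<one>\<^bsub>P\<^esub>)"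
      using S.m_inv_consistent[OF subK] D[OF d] by (simp add: carrier_semidirect)
    then have "(D ?d, \<one>\<^bsub>P\<^esub>) \<in> lower_central ?K (Suc i)"
      using subgroup.m_inv_closed[OF K'.lower_central_subgroup mem] by simp
    then show ?case by simp
  qed
  obtain c where "lower_central ?K c = {\<one>\<^bsub>S\<^esub>}"
    using nil by (auto simp: nilpotent_def)
  then have zero: "(D ^^ Suc c) w = \<one>\<^bsub>N\<^esub>" if "w \<in> carrier N" for w
    using lc[OF that, of c] by (simp add: one_semidirect)
  \<comment> \<open>Powers of \<open>D\<close> are removed one at a time: the quadratic case,
    applied to \<open>(D ^^ i) w\<close>, turns \<open>D ^^ (i + 2)\<close> vanishing at
    \<open>w\<close> into \<open>D ^^ (i + 1)\<close> vanishing there.\<close>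
  have descend: "D w = \<one>\<^bsub>N\<^esub>" if "w \<in> carrier N" "(D ^^ Suc i) w = \<one>\<^bsub>N\<^esub>" for i w
    using that(2)
  proof (induction i)
    case (Suc i)
    let ?u = "(D ^^ i) w"
    have u: "?u \<in> carrier N" using Dpow[OF that(1)] .
    have "\<phi> m (D ?u) \<otimes>\<^bsub>N\<^esub> inv\<^bsub>N\<^esub> (D ?u) = \<one>\<^bsub>N\<^esub>"
      using Suc.prems D_def[of "D ?u"] by simp
    then have "\<phi> m (D ?u) = D ?u"
      using D[OF u] m by (metis N.inv_solve_right N.l_one N.one_closed act_closed)
    then have "\<phi> m ?u = ?u"
      using act_eq_if_quadratic[OF comm tors m u] by (simp add: D_def)
    then have "(D ^^ Suc i) w = \<one>\<^bsub>N\<^esub>"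
      using u by (simp add: D_def)
    then show ?case by (rule Suc.IH)
  qed simp
  have "\<phi> m w = w" if "w \<in> carrier N" for w
    using descend[OF that zero[OF that]] that m unfolding D_def
    by (metis N.inv_solve_right N.l_one N.one_closed act_closed)
  then have "m = \<one>\<^bsub>P\<^esub>" using faithful[OF m] by blast
  with k v show "k \<in> carrier N \<times> {\<one>\<^bsub>P\<^esub>}" by simp
qed

lemma fitting_subgroup_semidirect:
  assumes comm: "comm_group N"
    and tors: "\<And>u. u \<in> carrier N \<Longrightarrow> u [^]\<^bsub>N\<^esub> order P = \<one>\<^bsub>N\<^esub> \<Longrightarrow> u = \<one>\<^bsub>N\<^esub>"
    and faithful: "\<And>m. m \<in> carrier P \<Longrightarrow> (\<And>w. w \<in> carrier N \<Longrightarrow> \<phi> m w = w) \<Longrightarrow> m = \<one>\<^bsub>P\<^esub>"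
  shows "fitting_subgroup S = kernel S P snd"
proof
  interpret S: group S by (rule group_semidirect)
  have sub: "subgroup (kernel S P snd) S"
    using group_hom.subgroup_kernel[OF group_hom_snd] .
  have "K \<subseteq> kernel S P snd" if "K \<lhd> S" "nilpotent (S\<lparr>carrier := K\<rparr>)" for K
    unfolding kernel_snd by (rule nilpotent_normal_subset_base[OF comm tors faithful that])
  then show "fitting_subgroup S \<subseteq> kernel S P snd"
    unfolding fitting_subgroup_def by (intro S.generate_subgroup_incl[OF _ sub]) blast
  let ?K = "S\<lparr>carrier := kernel S P snd\<rparr>"
  have "group_hom N ?K (\<lambda>a. (a, \<one>\<^bsub>P\<^esub>))"
    using S.subgroup_imp_group[OF sub] N.group_axioms
    by (auto simp: group_hom_def group_hom_axioms_def hom_def kernel_snd)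
  then have "nilpotent ?K"
    using group_hom.nilpotent_img comm_group.nilpotent[OF comm] by (fastforce simp: kernel_snd)
  then show "kernel S P snd \<subseteq> fitting_subgroup S"
    using S.subset_fitting_subgroup group_hom.normal_kernel[OF group_hom_snd] by blast
qed

end

section \<open>Redundant Sylow subgroups\<close>

context aut_action
begin

text \<open>The cyclic \<open>p\<close>-group generated by \<open>(a, x)\<close> acts on a set of
  size prime to \<open>p\<close>, so it fixes a point \<open>b\<close>. Such a \<open>b\<close>
  conjugates the complement \<open>P\<close> to one containing \<open>(a, x)\<close>.\<close>

lemma p_element_affine_fixed_point:
  assumes p: "Factorial_Ring.prime p" and fin: "finite (carrier N)" and p': "\<not> p dvd order N"
    and a: "a \<in> carrier N" and x: "x \<in> carrier P"
    and pow: "(a, x) [^]\<^bsub>S\<^esub> (p ^ k) = \<one>\<^bsub>S\<^esub>"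
  shows "\<exists>b\<in>carrier N. a \<otimes>\<^bsub>N\<^esub> \<phi> x b = b"
proof -
  interpret S: group S by (rule group_semidirect)
  have g: "(a, x) \<in> carrier S" using a x by (simp add: carrier_semidirect)
  let ?C = "generate S {(a, x)}"
  have C: "subgroup ?C S" using g by (intro S.generate_is_subgroup) simp
  interpret C: group "S\<lparr>carrier := ?C\<rparr>" using C by (rule S.subgroup_imp_group)
  have "S.ord (a, x) dvd p ^ k" using S.pow_eq_id[OF g] pow by blast
  then obtain j where "S.ord (a, x) = p ^ j" using divides_primepow_nat[OF p] by blast
  then have ord: "order (S\<lparr>carrier := ?C\<rparr>) = p ^ j"
    using S.generate_pow_card[OF g] by (simp add: order_def)
  \<comment> \<open>This is left multiplication on the cosets of the complement \<open>P\<close>,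
    where \<open>b\<close> stands for the coset of \<open>(b, 1)\<close>.\<close>
  let ?\<rho> = "\<lambda>(c, y) b. c \<otimes>\<^bsub>N\<^esub> \<phi> y b"
  have "group_action (S\<lparr>carrier := ?C\<rparr>) (carrier N) (\<lambda>g. restrict (?\<rho> g) (carrier N))"
  proof (rule group_actionI)
    show "?\<rho> h b \<in> carrier N" if "h \<in> carrier (S\<lparr>carrier := ?C\<rparr>)" "b \<in> carrier N" for h b
      using that subgroup.mem_carrier[OF C, of h] by (auto simp: carrier_semidirect)
    show "?\<rho> (h \<otimes>\<^bsub>S\<lparr>carrier := ?C\<rparr>\<^esub> h') b = ?\<rho> h (?\<rho> h' b)"
      if "h \<in> carrier (S\<lparr>carrier := ?C\<rparr>)" "h' \<in> carrier (S\<lparr>carrier := ?C\<rparr>)" "b \<in> carrier N" for h h' b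
      using that subgroup.mem_carrier[OF C, of h] subgroup.mem_carrier[OF C, of h']
      by (cases h, cases h') (auto simp: carrier_semidirect act_mult act_comp N.m_assoc)
  qed (auto simp: one_semidirect C.group_axioms)
  from group_action.card_mod_prime_eq_fixed[OF this p ord fin]
  have eq: "order N mod p = card {b \<in> carrier N. \<forall>h\<in>?C. restrict (?\<rho> h) (carrier N) b = b} mod p"
    by (simp add: order_def)
  have "{b \<in> carrier N. \<forall>h\<in>?C. restrict (?\<rho> h) (carrier N) b = b} \<noteq> {}"
  proof
    assume "{b \<in> carrier N. \<forall>h\<in>?C. restrict (?\<rho> h) (carrier N) b = b} = {}"
    with eq have "order N mod p = 0" by (simp only: card.empty mod_0)
    with p' show False by (simp add: dvd_eq_mod_eq_0)
  qed
  then obtain b where b: "b \<in> carrier N" "\<And>h. h \<in> ?C \<Longrightarrow> restrict (?\<rho> h) (carrier N) b = b"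
    by blast
  have "(a, x) \<in> ?C" by (rule generate.incl) simp
  from b(2)[OF this] b(1) show ?thesis by auto
qed

text \<open>This is the conjugate of the complement \<open>P\<close> by \<open>(b, 1)\<close>,
  multiplied out.\<close>

definition conj_complement :: "'b \<Rightarrow> ('b \<times> 'a) set" where
  "conj_complement b = (\<lambda>y. (b \<otimes>\<^bsub>N\<^esub> inv\<^bsub>N\<^esub> (\<phi> y b), y)) ` carrier P"

lemma conj_complement_subgroup:
  assumes b: "b \<in> carrier N"
  shows "subgroup (conj_complement b) S"
proof -
  have "b \<otimes>\<^bsub>N\<^esub> inv\<^bsub>N\<^esub> (\<phi> (x \<otimes>\<^bsub>P\<^esub> y) b) = b \<otimes>\<^bsub>N\<^esub> inv\<^bsub>N\<^esub> (\<phi> x b) \<otimes>\<^bsub>N\<^esub> \<phi> x (b \<otimes>\<^bsub>N\<^esub> inv\<^bsub>N\<^esub> (\<phi> y b))"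
    if "x \<in> carrier P" "y \<in> carrier P" for x y
    using that b by (simp add: act_mult act_inv act_comp N.m_assoc[of b "inv\<^bsub>N\<^esub> _"] N.m_assoc[symmetric, of "inv\<^bsub>N\<^esub> _"])
  then have "group_hom P S (\<lambda>y. (b \<otimes>\<^bsub>N\<^esub> inv\<^bsub>N\<^esub> (\<phi> y b), y))"
    using b by (auto simp: group_hom_def group_hom_axioms_def hom_def group_semidirect
        P.group_axioms carrier_semidirect)
  then show ?thesis
    unfolding conj_complement_def using group_hom.img_is_subgroup by blast
qed

lemma card_conj_complement: "card (conj_complement b) = order P"
  unfolding conj_complement_def order_def by (rule card_image) (auto simp: inj_on_def)

text \<open>A conjugate complement is the graph of a function on \<open>P\<close>, for the trivial
  conjugator a constant one. Comparing values shows that \<open>P\<close> fixes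
  \<open>b\<close>.\<close>

lemma conj_complement_eq_imp:
  assumes "fixed_points N P \<phi> = {\<one>\<^bsub>N\<^esub>}" "b \<in> carrier N" "conj_complement b = conj_complement \<one>\<^bsub>N\<^esub>"
  shows "b = \<one>\<^bsub>N\<^esub>"
proof -
  have "\<phi> y b = b" if y: "y \<in> carrier P" for y
  proof -
    have "(b \<otimes>\<^bsub>N\<^esub> inv\<^bsub>N\<^esub> (\<phi> y b), y) \<in> conj_complement \<one>\<^bsub>N\<^esub>"
      using assms(3) y by (auto simp: conj_complement_def)
    then have "b \<otimes>\<^bsub>N\<^esub> inv\<^bsub>N\<^esub> (\<phi> y b) = \<one>\<^bsub>N\<^esub>"
      using y by (auto simp: conj_complement_def)
    then show ?thesis
      using assms(2) y by (metis N.inv_equality N.inv_inv N.inv_closed act_closed)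
  qed
  then show ?thesis using assms(1,2) by (auto simp: fixed_points_def)
qed

text \<open>The Sylow subgroup left out is the complement \<open>P\<close> itself. Each
  \<open>p\<close>-element must therefore be placed in \<open>conj_complement d\<close> for some
  nontrivial \<open>d\<close>.\<close>

lemma has_redundant_sylowI:
  assumes p: "Factorial_Ring.prime p" and ordP: "order P = p ^ n"
    and fin: "finite (carrier N)" and p': "\<not> p dvd order N"
    and fixed: "fixed_points N P \<phi> = {\<one>\<^bsub>N\<^esub>}"
    and centralizer: "\<And>x. x \<in> carrier P \<Longrightarrow> \<exists>c\<in>carrier N. c \<noteq> \<one>\<^bsub>N\<^esub> \<and> \<phi> x c = c"
  shows "has_redundant_sylow p S"
proof -
  have "order N \<noteq> 0" using p' by (metis dvd_0_right)
  then have "multiplicity p (order S) = n"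
    using p p' prime_gt_1_nat[OF p] by (simp add: order_semidirect ordP prime_elem_multiplicity_mult_distrib
        not_dvd_imp_multiplicity_0 prime_gt_0_nat multiplicity_same_power')
  then have syl: "conj_complement b \<in> sylow_subgroups p S" if "b \<in> carrier N" for b
    using that conj_complement_subgroup by (simp add: sylow_subgroups_def card_conj_complement ordP)
  let ?T = "sylow_subgroups p S - {conj_complement \<one>\<^bsub>N\<^esub>}"
  have "?T \<subset> sylow_subgroups p S" using syl[OF N.one_closed] by blast
  moreover have "p_elements p S \<subseteq> \<Union>?T"
  proof
    fix g assume "g \<in> p_elements p S"
    then obtain k :: nat where g: "g \<in> carrier S" "g [^]\<^bsub>S\<^esub> (p ^ k) = \<one>\<^bsub>S\<^esub>"
      by (auto simp: p_elements_def)
    obtain a x where ax: "g = (a, x)" by (cases g)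
    have a: "a \<in> carrier N" and x: "x \<in> carrier P" using g(1) ax by (auto simp: carrier_semidirect)
    obtain b where b: "b \<in> carrier N" "a \<otimes>\<^bsub>N\<^esub> \<phi> x b = b"
      using p_element_affine_fixed_point[OF p fin p' a x] g(2) ax by blast
    have mem: "g \<in> conj_complement d" if "d \<in> carrier N" "a \<otimes>\<^bsub>N\<^esub> \<phi> x d = d" for d
    proof -
      have "a = d \<otimes>\<^bsub>N\<^esub> inv\<^bsub>N\<^esub> (\<phi> x d)"
        using that a x by (metis N.inv_solve_right act_closed)
      with x show ?thesis unfolding ax conj_complement_def by blast
    qed
    obtain c where c: "c \<in> carrier N" "c \<noteq> \<one>\<^bsub>N\<^esub>" "\<phi> x c = c" using centralizer[OF x] by blast
    have bc: "b \<otimes>\<^bsub>N\<^esub> c \<in> carrier N" "a \<otimes>\<^bsub>N\<^esub> \<phi> x (b \<otimes>\<^bsub>N\<^esub> c) = b \<otimes>\<^bsub>N\<^esub> c"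
      using a b c x by (auto simp: act_mult N.m_assoc[symmetric])
    \<comment> \<open>Both \<open>b\<close> and its product with \<open>c\<close> are fixed by the
      affine map of \<open>g\<close>, and they cannot both be trivial because \<open>c\<close> is
      not.\<close>
    obtain d where d: "d \<in> carrier N" "a \<otimes>\<^bsub>N\<^esub> \<phi> x d = d" "d \<noteq> \<one>\<^bsub>N\<^esub>"
      using b bc c by (metis N.l_one)
    then have "conj_complement d \<in> ?T"
      using syl[OF d(1)] conj_complement_eq_imp[OF fixed d(1)] by auto
    with mem[OF d(1,2)] show "g \<in> \<Union>?T" by (rule UnionI[rotated])
  qed
  ultimately show ?thesis unfolding has_redundant_sylow_def by blast
qed

text \<open>The order of \<open>N\<close> is congruent modulo \<open>p\<close> to the number of
  fixed points, which is 1. Thus the inductive construction does not have to track coprimality to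
  \<open>p\<close>.\<close>

lemma not_dvd_order_if_fixed_points_trivial:
  assumes p: "Factorial_Ring.prime p" and ordP: "order P = p ^ n" and fin: "finite (carrier N)"
    and fixed: "fixed_points N P \<phi> = {\<one>\<^bsub>N\<^esub>}"
  shows "\<not> p dvd order N"
proof -
  have "{a \<in> carrier N. \<forall>x\<in>carrier P. restrict (\<phi> x) (carrier N) a = a} = fixed_points N P \<phi>"
    by (auto simp: fixed_points_def)
  then have "order N mod p = 1 mod p"
    using group_action.card_mod_prime_eq_fixed[OF group_action_act p ordP fin] fixed
    by (simp add: order_def)
  then show ?thesis
    using prime_gt_1_nat[OF p] by (simp add: dvd_eq_mod_eq_0)
qed

end

section \<open>Modules of functions on a group\<close>

definition translate :: "('g, 'z) monoid_scheme \<Rightarrow> 'g \<Rightarrow> ('g \<Rightarrow> int) \<Rightarrow> 'g \<Rightarrow> int" where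
  "translate G g f = (\<lambda>x. if x \<in> carrier G then f (inv\<^bsub>G\<^esub> g \<otimes>\<^bsub>G\<^esub> x) else 0)"

text \<open>Integers modulo \<open>r\<close> are represented by reduced residues, and functions
  vanish off the carrier, so equality in the module is equality of functions.\<close>

definition function_module ::
    "('g, 'z) monoid_scheme \<Rightarrow> 'g set \<Rightarrow> 'g set \<Rightarrow> int \<Rightarrow> ('g \<Rightarrow> int) monoid" where
  "function_module G M L r =
     \<lparr>carrier = {f. (\<forall>x. f x mod r = f x) \<and> (\<forall>x. x \<notin> carrier G \<longrightarrow> f x = 0)
        \<and> (\<forall>x\<in>carrier G. \<forall>m\<in>M. f (x \<otimes>\<^bsub>G\<^esub> m) = f x)
        \<and> (\<forall>x\<in>carrier G. (\<Sum>l\<in>L. f (x \<otimes>\<^bsub>G\<^esub> l)) mod r = 0)},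
      monoid.mult = (\<lambda>f g x. (f x + g x) mod r),
      one = (\<lambda>_. 0)\<rparr>"

locale translation_module = group G for G (structure) +
  fixes M L :: "'a set" and r :: int
  assumes fin: "finite (carrier G)" and M: "M \<lhd> G" and L: "L \<lhd> G"
    and r: "1 < r" and coprime_L: "coprime (int (card L)) r"
begin

abbreviation (input) V where "V \<equiv> function_module G M L r"

lemma M_carrier: "m \<in> M \<Longrightarrow> m \<in> carrier G"
  using M normal_imp_subgroup subgroup.mem_carrier by metis

lemma L_carrier: "l \<in> L \<Longrightarrow> l \<in> carrier G"
  using L normal_imp_subgroup subgroup.mem_carrier by metis

lemma mult_V: "f \<otimes>\<^bsub>V\<^esub> g = (\<lambda>x. (f x + g x) mod r)"
  by (simp add: function_module_def)

lemma one_V: "\<one>\<^bsub>V\<^esub> = (\<lambda>_. 0)"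
  by (simp add: function_module_def)

lemma in_carrier_V: "f \<in> carrier V \<longleftrightarrow>
    (\<forall>x. f x mod r = f x) \<and> (\<forall>x. x \<notin> carrier G \<longrightarrow> f x = 0)
    \<and> (\<forall>x\<in>carrier G. \<forall>m\<in>M. f (x \<otimes> m) = f x)
    \<and> (\<forall>x\<in>carrier G. (\<Sum>l\<in>L. f (x \<otimes> l)) mod r = 0)"
  by (simp add: function_module_def)

lemma comm_group_V: "comm_group V"
proof (rule comm_groupI)
  fix f g assume f: "f \<in> carrier V" and g: "g \<in> carrier V"
  have "(\<Sum>l\<in>L. (f (x \<otimes> l) + g (x \<otimes> l)) mod r) mod r = 0" if "x \<in> carrier G" for x
  proof -
    have "((\<Sum>l\<in>L. f (x \<otimes> l)) + (\<Sum>l\<in>L. g (x \<otimes> l))) mod r = 0"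
      using f g that by (subst mod_add_eq[symmetric]) (simp add: in_carrier_V)
    then show ?thesis by (simp add: mod_sum_eq sum.distrib)
  qed
  then show "f \<otimes>\<^bsub>V\<^esub> g \<in> carrier V"
    using f g by (auto simp: in_carrier_V mult_V)
next
  fix f assume f: "f \<in> carrier V"
  have "(\<Sum>l\<in>L. (- f (x \<otimes> l)) mod r) mod r = 0" if "x \<in> carrier G" for x
  proof -
    have "(- (\<Sum>l\<in>L. f (x \<otimes> l))) mod r = 0"
      using f that by (simp add: in_carrier_V mod_minus_eq[symmetric])
    then show ?thesis by (simp add: mod_sum_eq sum_negf)
  qed
  then have "(\<lambda>x. (- f x) mod r) \<in> carrier V"
    using f by (auto simp: in_carrier_V)
  moreover have "(\<lambda>x. (- f x) mod r) \<otimes>\<^bsub>V\<^esub> f = \<one>\<^bsub>V\<^esub>"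
    by (simp add: mult_V one_V mod_add_left_eq)
  ultimately show "\<exists>g\<in>carrier V. g \<otimes>\<^bsub>V\<^esub> f = \<one>\<^bsub>V\<^esub>" by blast
qed (auto simp: in_carrier_V mult_V one_V mod_simps ac_simps)

lemma finite_V: "finite (carrier V)"
proof (rule finite_subset)
  show "carrier V \<subseteq> {f. \<forall>x. (x \<in> carrier G \<longrightarrow> f x \<in> {0..<r}) \<and> (x \<notin> carrier G \<longrightarrow> f x = 0)}"
  proof clarsimp
    fix f x assume f: "f \<in> carrier V"
    have "f x mod r = f x" using f by (simp add: in_carrier_V)
    then have "0 \<le> f x" "f x < r"
      using r pos_mod_sign[of r "f x"] pos_mod_bound[of r "f x"] by simp_all
    then show "(x \<in> carrier G \<longrightarrow> 0 \<le> f x \<and> f x < r) \<and> (x \<notin> carrier G \<longrightarrow> f x = 0)"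
      using f by (simp add: in_carrier_V)
  qed
  show "finite {f. \<forall>x. (x \<in> carrier G \<longrightarrow> f x \<in> {0..<r}) \<and> (x \<notin> carrier G \<longrightarrow> f x = 0)}"
    by (rule finite_set_of_finite_funs) (auto simp: fin)
qed

text \<open>No primality of \<open>r\<close> is assumed, so factors are cancelled by coprimality
  alone.\<close>

lemma eq_0_if_coprime_mult:
  assumes "f \<in> carrier V" "coprime d r" "(d * f x) mod r = 0"
  shows "f x = 0"
proof -
  have "r dvd f x"
    using assms(2,3) by (metis coprime_commute coprime_dvd_mult_right_iff mod_0_imp_dvd)
  then have "f x mod r = 0" by simp
  with assms(1) show ?thesis by (simp add: in_carrier_V)
qed

lemma pow_V:
  assumes "f \<in> carrier V"
  shows "f [^]\<^bsub>V\<^esub> (d :: nat) = (\<lambda>x. (int d * f x) mod r)"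
proof -
  interpret V: comm_group V by (rule comm_group_V)
  show ?thesis
    using r by (induction d) (auto simp: mult_V one_V fun_eq_iff mod_simps algebra_simps)
qed

lemma pow_V_eq_one_imp:
  assumes "f \<in> carrier V" "coprime (int d) r" "f [^]\<^bsub>V\<^esub> d = \<one>\<^bsub>V\<^esub>"
  shows "f = \<one>\<^bsub>V\<^esub>"
proof -
  have "(int d * f x) mod r = 0" for x
    using assms(3) by (simp add: pow_V[OF assms(1)] one_V fun_eq_iff)
  then show ?thesis
    unfolding one_V by (intro ext eq_0_if_coprime_mult[OF assms(1,2)])
qed

lemma aut_action_translate: "aut_action V G (translate G)"
proof (rule aut_action.intro)
  show "group V" using comm_group_V by (simp add: comm_group_def)
  show "group G" by (rule group_axioms)
  show "aut_action_axioms V G (translate G)"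
  proof
    fix g f assume g: "g \<in> carrier G" and f: "f \<in> carrier V"
    show "translate G g f \<in> carrier V"
      using g f by (auto simp: in_carrier_V translate_def m_assoc[symmetric] M_carrier L_carrier cong: sum.cong)
  next
    fix g h f assume "g \<in> carrier G" "h \<in> carrier G" "f \<in> carrier V"
    then show "translate G (g \<otimes> h) f = translate G g (translate G h f)"
      by (auto simp: translate_def inv_mult_group m_assoc)
  qed (auto simp: translate_def mult_V in_carrier_V fun_eq_iff)
qed

text \<open>Normality converts right into left invariance: \<open>inv m\<close> times
  \<open>x\<close> is \<open>x\<close> times a conjugate of \<open>inv m\<close>, which lies in
  \<open>M\<close>.\<close>

lemma translate_M_trivial:
  assumes f: "f \<in> carrier V" and m: "m \<in> M"
  shows "translate G m f = f"
proof
  fix x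
  have "f (inv m \<otimes> x) = f x" if x: "x \<in> carrier G"
  proof -
    have "inv x \<otimes> inv m \<otimes> x \<in> M"
      using x m normal.inv_op_closed1[OF M x] subgroup.m_inv_closed[OF normal_imp_subgroup[OF M]] by blast
    then have "f (x \<otimes> (inv x \<otimes> inv m \<otimes> x)) = f x"
      using f x by (simp add: in_carrier_V)
    moreover have "x \<otimes> (inv x \<otimes> inv m \<otimes> x) = inv m \<otimes> x"
      using x M_carrier[OF m] by (simp add: m_assoc[symmetric])
    ultimately show ?thesis by simp
  qed
  then show "translate G m f x = f x"
    using f by (simp add: translate_def in_carrier_V)
qed

text \<open>By normality a fixed \<open>f\<close> is constant on each coset \<open>xL\<close>. The
  coset sum is then \<open>card L\<close> times \<open>f x\<close>, it vanishes modulo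
  \<open>r\<close>, and \<open>card L\<close> is invertible there.\<close>

lemma translate_L_fixed_imp:
  assumes f: "f \<in> carrier V" and fixed: "\<And>l. l \<in> L \<Longrightarrow> translate G l f = f"
  shows "f = \<one>\<^bsub>V\<^esub>"
proof -
  have "f x = 0" if x: "x \<in> carrier G" for x
  proof -
    have "f (x \<otimes> l) = f x" if l: "l \<in> L" for l
    proof -
      let ?k = "x \<otimes> l \<otimes> inv x"
      have k: "?k \<in> L" using normal.inv_op_closed2[OF L x l] .
      then have "translate G (inv ?k) f = f"
        using fixed subgroup.m_inv_closed[OF normal_imp_subgroup[OF L]] by blast
      then have "f (?k \<otimes> x) = f x"
        using x L_carrier[OF k] by (metis inv_inv translate_def)
      moreover have "?k \<otimes> x = x \<otimes> l"
        using x L_carrier[OF l] by (simp add: m_assoc)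
      ultimately show ?thesis by simp
    qed
    then have "(\<Sum>l\<in>L. f (x \<otimes> l)) = int (card L) * f x" by simp
    then have "(int (card L) * f x) mod r = 0"
      using f x unfolding in_carrier_V by metis
    then show ?thesis by (rule eq_0_if_coprime_mult[OF f coprime_L])
  qed
  then show ?thesis using f unfolding in_carrier_V one_V by blast
qed

text \<open>The witness is the indicator function of \<open>H\<close> minus that of \<open>Hz\<close>.\<close>

lemma ex_translate_invariant:
  assumes H: "subgroup H G" and MH: "M \<subseteq> H" and z: "z \<in> L" "z \<notin> H"
  shows "\<exists>f\<in>carrier V. f \<one> = 1 \<and> (\<forall>h\<in>H. translate G h f = f)
    \<and> (\<forall>x\<in>carrier G. f x \<noteq> 0 \<longrightarrow> x \<in> H \<or> x \<otimes> inv z \<in> H)"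
proof -
  interpret H: subgroup H G by fact
  have zG: "z \<in> carrier G" using z L_carrier by blast
  have right: "x \<otimes> h \<in> H \<longleftrightarrow> x \<in> H" if "x \<in> carrier G" "h \<in> H" for x h
  proof
    assume "x \<otimes> h \<in> H"
    then have "x \<otimes> h \<otimes> inv h \<in> H" using that by simp
    then show "x \<in> H" using that by (simp add: m_assoc)
  qed (use that in simp)
  have left: "inv h \<otimes> x \<in> H \<longleftrightarrow> x \<in> H" if "x \<in> carrier G" "h \<in> H" for x h
  proof
    assume "inv h \<otimes> x \<in> H"
    then have "h \<otimes> (inv h \<otimes> x) \<in> H" using that by simp
    then show "x \<in> H" using that by (simp add: m_assoc[symmetric])
  qed (use that in simp)
  define ind :: "'a \<Rightarrow> int" where "ind x = (if x \<in> H then 1 else 0)" for x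
  define f where "f x = (if x \<in> carrier G then (ind x - ind (x \<otimes> inv z)) mod r else 0)" for x
  have "f \<in> carrier V"
    unfolding in_carrier_V
  proof (intro conjI ballI allI impI)
    fix x m assume x: "x \<in> carrier G" and m: "m \<in> M"
    \<comment> \<open>Right invariance of \<open>Hz\<close> under \<open>M\<close>: moving
      \<open>m\<close> past \<open>z\<close> conjugates it inside the normal subgroup
      \<open>M\<close>, hence inside \<open>H\<close>.\<close>
    have "z \<otimes> m \<otimes> inv z \<in> H" using normal.inv_op_closed2[OF M zG m] MH by blast
    then have "x \<otimes> inv z \<otimes> (z \<otimes> m \<otimes> inv z) \<in> H \<longleftrightarrow> x \<otimes> inv z \<in> H"
      using x zG by (intro right) auto
    moreover have "x \<otimes> inv z \<otimes> (z \<otimes> m \<otimes> inv z) = x \<otimes> m \<otimes> inv z"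
    proof -
      have "x \<otimes> inv z \<otimes> (z \<otimes> m \<otimes> inv z) = x \<otimes> (inv z \<otimes> z) \<otimes> m \<otimes> inv z"
        using x zG M_carrier[OF m] by (simp only: m_assoc m_closed inv_closed)
      then show ?thesis using x zG by simp
    qed
    moreover have "x \<otimes> m \<in> H \<longleftrightarrow> x \<in> H" using right x m MH by blast
    ultimately show "f (x \<otimes> m) = f x"
      using x M_carrier[OF m] by (simp add: f_def ind_def)
  next
    fix x assume x: "x \<in> carrier G"
    \<comment> \<open>As \<open>z\<close> lies in \<open>L\<close>, right multiplication by
      \<open>inv z\<close> permutes \<open>L\<close>, so the two indicators have equal sums over
      every coset of \<open>L\<close>.\<close>
    have "bij_betw (\<lambda>l. l \<otimes> inv z) L L"
    proof (rule bij_betw_byWitness[where f' = "\<lambda>l. l \<otimes> z"])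
      show "(\<lambda>l. l \<otimes> inv z) ` L \<subseteq> L" "(\<lambda>l. l \<otimes> z) ` L \<subseteq> L"
        using z(1) normal_imp_subgroup[OF L] by (auto simp: subgroup.m_closed subgroup.m_inv_closed)
    qed (use zG L_carrier in \<open>auto simp: m_assoc\<close>)
    then have "(\<Sum>l\<in>L. ind (x \<otimes> (l \<otimes> inv z))) = (\<Sum>l\<in>L. ind (x \<otimes> l))"
      by (rule sum.reindex_bij_betw)
    then have "(\<Sum>l\<in>L. ind (x \<otimes> l) - ind (x \<otimes> l \<otimes> inv z)) = 0"
      using x zG L_carrier by (simp add: sum_subtractf m_assoc cong: sum.cong)
    then have "(\<Sum>l\<in>L. (ind (x \<otimes> l) - ind (x \<otimes> l \<otimes> inv z)) mod r) mod r = 0"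
      by (simp add: mod_sum_eq)
    then show "(\<Sum>l\<in>L. f (x \<otimes> l)) mod r = 0"
      using x L_carrier by (simp add: f_def cong: sum.cong)
  qed (auto simp: f_def)
  moreover have "inv z \<notin> H"
    using z(2) zG H.m_inv_closed by (metis inv_inv)
  then have "f \<one> = 1" using r zG by (simp add: f_def ind_def)
  moreover have "translate G h f = f" if h: "h \<in> H" for h
  proof
    fix x show "translate G h f x = f x"
      using left[of x h] left[of "x \<otimes> inv z" h] h zG
      by (auto simp: translate_def f_def ind_def m_assoc)
  qed
  moreover have "x \<in> H \<or> x \<otimes> inv z \<in> H" if "f x \<noteq> 0" for x
    using that by (auto simp: f_def ind_def split: if_splits)
  ultimately show ?thesis by blast
qed

text \<open>The witness for \<open>H = M\<close> is 1 at the identity and supported in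
  \<open>L\<close>. Its translate by \<open>g\<close> is 1 at \<open>g\<close>, so invariance puts
  \<open>g\<close> into the support.\<close>

lemma translate_trivial_imp:
  assumes psub: "M \<subset> L" and g: "g \<in> carrier G"
    and triv: "\<And>f. f \<in> carrier V \<Longrightarrow> translate G g f = f"
  shows "g \<in> L"
proof -
  obtain z where z: "z \<in> L" "z \<notin> M" using psub by blast
  obtain f where f: "f \<in> carrier V" "f \<one> = 1"
    and supp: "\<forall>x\<in>carrier G. f x \<noteq> 0 \<longrightarrow> x \<in> M \<or> x \<otimes> inv z \<in> M"
    using ex_translate_invariant[OF normal_imp_subgroup[OF M] _ z] by blast
  have "translate G g f g = 1" using g f by (simp add: translate_def)
  then have "f g \<noteq> 0" using triv[OF f(1)] by simp
  then have "g \<in> L \<or> g \<otimes> inv z \<in> L" using supp g psub by blast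
  moreover have "g \<otimes> inv z \<otimes> z = g" using g L_carrier[OF z(1)] by (simp add: m_assoc)
  ultimately show ?thesis
    using subgroup.m_closed[OF normal_imp_subgroup[OF L] _ z(1)] by metis
qed

end

section \<open>Raising the Fitting height\<close>

lemma (in comm_group) solvable: "solvable G"
proof -
  have "(derived G ^^ Suc 0) (carrier G) = {\<one>}" using derived_eq_singleton by simp
  then show ?thesis unfolding solvable_iff_trivial_derived_seq by blast
qed

section \<open>Extending the group acted on by a module\<close>

context aut_action
begin

lemma aut_action_base:
  assumes "aut_action V S \<theta>"
  shows "aut_action V N (\<lambda>m. \<theta> (m, \<one>\<^bsub>P\<^esub>))"
proof -
  interpret V: aut_action V S \<theta> by fact
  have "\<theta> (m \<otimes>\<^bsub>N\<^esub> m', \<one>\<^bsub>P\<^esub>) v = \<theta> (m, \<one>\<^bsub>P\<^esub>) (\<theta> (m', \<one>\<^bsub>P\<^esub>) v)"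
    if "m \<in> carrier N" "m' \<in> carrier N" "v \<in> carrier V" for m m' v
    using that V.act_comp[of "(m, \<one>\<^bsub>P\<^esub>)" "(m', \<one>\<^bsub>P\<^esub>)" v] by (simp add: carrier_semidirect)
  then show ?thesis
    using V.act_one by unfold_locales (auto simp: V.act_mult carrier_semidirect one_semidirect)
qed

text \<open>This rebrackets an iterated semidirect product, \<open>V\<close> by (\<open>N\<close> by
  \<open>P\<close>), as (\<open>V\<close> by \<open>N\<close>) by \<open>P\<close>.\<close>

lemma aut_action_complement:
  assumes "aut_action V S \<theta>"
  shows "aut_action (semidirect_product V N (\<lambda>m. \<theta> (m, \<one>\<^bsub>P\<^esub>))) P
    (\<lambda>y (v, m). (\<theta> (\<one>\<^bsub>N\<^esub>, y) v, \<phi> y m))"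
proof -
  interpret V: aut_action V S \<theta> by fact
  interpret B: aut_action V N "\<lambda>m. \<theta> (m, \<one>\<^bsub>P\<^esub>)" using assms by (rule aut_action_base)
  interpret VN: group "semidirect_product V N (\<lambda>m. \<theta> (m, \<one>\<^bsub>P\<^esub>))" by (rule B.group_semidirect)
  have comp: "\<theta> (\<one>\<^bsub>N\<^esub>, x \<otimes>\<^bsub>P\<^esub> y) v = \<theta> (\<one>\<^bsub>N\<^esub>, x) (\<theta> (\<one>\<^bsub>N\<^esub>, y) v)"
    if "x \<in> carrier P" "y \<in> carrier P" "v \<in> carrier V" for x y v
    using that V.act_comp[of "(\<one>\<^bsub>N\<^esub>, x)" "(\<one>\<^bsub>N\<^esub>, y)" v] by (simp add: carrier_semidirect)
  \<comment> \<open>Both sides are the action of one element of \<open>S\<close>, since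
    \<open>(1, y) (m, 1)\<close> equals \<open>(\<phi> y m, 1) (1, y)\<close>.\<close>
  have swap: "\<theta> (\<one>\<^bsub>N\<^esub>, y) (\<theta> (m, \<one>\<^bsub>P\<^esub>) v) = \<theta> (\<phi> y m, \<one>\<^bsub>P\<^esub>) (\<theta> (\<one>\<^bsub>N\<^esub>, y) v)"
    if "y \<in> carrier P" "m \<in> carrier N" "v \<in> carrier V" for y m v
    using that V.act_comp[of "(\<one>\<^bsub>N\<^esub>, y)" "(m, \<one>\<^bsub>P\<^esub>)" v] V.act_comp[of "(\<phi> y m, \<one>\<^bsub>P\<^esub>)" "(\<one>\<^bsub>N\<^esub>, y)" v]
    by (simp add: carrier_semidirect)
  show ?thesis
    using V.act_one
    by unfold_locales
      (auto simp: B.carrier_semidirect carrier_semidirect one_semidirect V.act_mult act_mult comp act_comp swap)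
qed

lemma subgroup_complement_subset:
  assumes H: "subgroup H P"
  shows "subgroup ({\<one>\<^bsub>N\<^esub>} \<times> H) S"
proof -
  interpret S: group S by (rule group_semidirect)
  interpret H: subgroup H P by fact
  show ?thesis
  proof (rule S.subgroupI)
    show "{\<one>\<^bsub>N\<^esub>} \<times> H \<noteq> {}" using H.one_closed by blast
  qed (auto simp: carrier_semidirect inv_semidirect)
qed

lemma normal_complement_subset:
  assumes L: "L \<lhd> P" and triv: "\<And>l a. l \<in> L \<Longrightarrow> a \<in> carrier N \<Longrightarrow> \<phi> l a = a"
  shows "{\<one>\<^bsub>N\<^esub>} \<times> L \<lhd> S"
proof -
  interpret S: group S by (rule group_semidirect)
  interpret L: normal L P by fact
  have "subgroup ({\<one>\<^bsub>N\<^esub>} \<times> L) S"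
    using L.subgroup_axioms by (rule subgroup_complement_subset)
  moreover have "g \<otimes>\<^bsub>S\<^esub> h \<otimes>\<^bsub>S\<^esub> inv\<^bsub>S\<^esub> g \<in> {\<one>\<^bsub>N\<^esub>} \<times> L" if gh: "g \<in> carrier S" "h \<in> {\<one>\<^bsub>N\<^esub>} \<times> L" for g h
  proof -
    obtain a x l where g: "g = (a, x)" "a \<in> carrier N" "x \<in> carrier P" and h: "h = (\<one>\<^bsub>N\<^esub>, l)" "l \<in> L"
      using gh by (auto simp: carrier_semidirect)
    have conj: "x \<otimes>\<^bsub>P\<^esub> l \<otimes>\<^bsub>P\<^esub> inv\<^bsub>P\<^esub> x \<in> L" using L.inv_op_closed2 g h by blast
    have "\<phi> (x \<otimes>\<^bsub>P\<^esub> l) (\<phi> (inv\<^bsub>P\<^esub> x) (inv\<^bsub>N\<^esub> a)) = \<phi> (x \<otimes>\<^bsub>P\<^esub> l \<otimes>\<^bsub>P\<^esub> inv\<^bsub>P\<^esub> x) (inv\<^bsub>N\<^esub> a)"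
      using g h by (simp add: act_comp)
    also have "\<dots> = inv\<^bsub>N\<^esub> a" using triv conj g by simp
    finally show ?thesis using g h conj by (simp add: inv_semidirect)
  qed
  ultimately show ?thesis by (simp add: S.normal_inv_iff)
qed

text \<open>The module lives on \<open>S\<close>, where the copies of \<open>M\<close> and
  \<open>L\<close> are normal because \<open>L\<close> acts trivially on \<open>N\<close>. The last
  two conjuncts supply the centralised elements: from \<open>N\<close> for elements of
  \<open>L\<close>, from the module for subgroups not containing \<open>L\<close>.\<close>

lemma ex_extension:
  assumes finN: "finite (carrier N)" and finP: "finite (carrier P)"
    and M: "M \<lhd> P" and L: "L \<lhd> P" and psub: "M \<subset> L"
    and L_triv: "\<forall>l\<in>L. \<forall>a\<in>carrier N. \<phi> l a = a"
    and fixed: "fixed_points N P \<phi> = {\<one>\<^bsub>N\<^esub>}"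
    and solv: "solvable N" and height: "has_fitting_height N k"
  shows "\<exists>(B :: (('b \<times> 'a \<Rightarrow> int) \<times> 'b) monoid) \<psi>. aut_action B P \<psi> \<and> finite (carrier B)
    \<and> solvable B \<and> has_fitting_height B (Suc k) \<and> fixed_points B P \<psi> = {\<one>\<^bsub>B\<^esub>}
    \<and> (\<forall>m\<in>M. \<forall>b\<in>carrier B. \<psi> m b = b)
    \<and> (carrier N \<noteq> {\<one>\<^bsub>N\<^esub>} \<longrightarrow> (\<forall>x\<in>L. \<exists>c\<in>carrier B. c \<noteq> \<one>\<^bsub>B\<^esub> \<and> \<psi> x c = c))
    \<and> (\<forall>H. subgroup H P \<longrightarrow> M \<subseteq> H \<longrightarrow> \<not> L \<subseteq> H \<longrightarrow>
         (\<exists>c\<in>carrier B. c \<noteq> \<one>\<^bsub>B\<^esub> \<and> (\<forall>x\<in>H. \<psi> x c = c)))"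
proof -
  let ?M = "{\<one>\<^bsub>N\<^esub>} \<times> M" and ?L = "{\<one>\<^bsub>N\<^esub>} \<times> L"
  define r where "r = int (order N * order P + 1)"
  have coprime_r: "coprime (int d) r" if "d dvd order N * order P" for d
  proof -
    have "coprime d (order N * order P + 1)"
      using that by (metis coprime_add_one_right coprime_divisors dvd_refl)
    then show ?thesis unfolding r_def by (simp only: coprime_int_iff)
  qed
  have "order N > 0" "order P > 0"
    using finN finP by (simp_all add: N.order_gt_0_iff_finite P.order_gt_0_iff_finite)
  then have r: "1 < r" by (simp add: r_def)
  interpret S: group S by (rule group_semidirect)
  have triv: "\<phi> l a = a" if "l \<in> L" "a \<in> carrier N" for l a
    using that L_triv by blast
  have trivM: "\<phi> m a = a" if "m \<in> M" "a \<in> carrier N" for m a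
    using that triv psub by blast
  have LP: "l \<in> carrier P" if "l \<in> L" for l
    by (rule subgroup.mem_carrier[OF normal_imp_subgroup[OF L] that])
  have "card L dvd order P"
    using P.lagrange[OF normal_imp_subgroup[OF L]] by (metis dvd_triv_right)
  then have copL: "coprime (int (card ?L)) r"
    by (intro coprime_r) (simp add: card_cartesian_product)
  let ?V = "function_module S ?M ?L r"
  interpret T: translation_module S ?M ?L r
    using finN finP r copL normal_complement_subset[OF M trivM] normal_complement_subset[OF L triv]
    by (auto simp: carrier_semidirect S.group_axioms
        intro!: translation_module.intro translation_module_axioms.intro)
  interpret \<theta>: aut_action ?V S "translate S" by (rule T.aut_action_translate)
  interpret V: comm_group ?V by (rule T.comm_group_V)
  interpret B: aut_action ?V N "\<lambda>m. translate S (m, \<one>\<^bsub>P\<^esub>)"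
    using \<theta>.aut_action_axioms by (rule aut_action_base)
  let ?B = "semidirect_product ?V N (\<lambda>m. translate S (m, \<one>\<^bsub>P\<^esub>))"
  let ?\<psi> = "\<lambda>y (v, m). (translate S (\<one>\<^bsub>N\<^esub>, y) v, \<phi> y m)"
  have action: "aut_action ?B P ?\<psi>"
    using \<theta>.aut_action_axioms by (rule aut_action_complement)
  \<comment> \<open>A kernel element of the module action lies in the copy of \<open>L\<close>,
    which meets the base \<open>N\<close> trivially.\<close>
  have faithful: "m = \<one>\<^bsub>N\<^esub>"
    if "m \<in> carrier N" "\<And>w. w \<in> carrier ?V \<Longrightarrow> translate S (m, \<one>\<^bsub>P\<^esub>) w = w" for m
  proof -
    have "(m, \<one>\<^bsub>P\<^esub>) \<in> ?L"
    proof (rule T.translate_trivial_imp)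
      show "?M \<subset> ?L" using psub by blast
      show "(m, \<one>\<^bsub>P\<^esub>) \<in> carrier S" using that(1) by (simp add: carrier_semidirect)
    qed (rule that(2))
    then show ?thesis by simp
  qed
  have fixer: "\<exists>c\<in>carrier ?B. c \<noteq> \<one>\<^bsub>?B\<^esub> \<and> (\<forall>x\<in>H. ?\<psi> x c = c)"
    if H: "subgroup H P" and MH: "M \<subseteq> H" and LH: "\<not> L \<subseteq> H" for H
  proof -
    obtain z where z: "z \<in> L" "z \<notin> H" using LH by blast
    have "subgroup ({\<one>\<^bsub>N\<^esub>} \<times> H) S"
      using H by (rule subgroup_complement_subset)
    from T.ex_translate_invariant[OF this, of "(\<one>\<^bsub>N\<^esub>, z)"] MH z
    obtain f where f: "f \<in> carrier ?V" "f \<one>\<^bsub>S\<^esub> = 1" "\<And>h. h \<in> {\<one>\<^bsub>N\<^esub>} \<times> H \<Longrightarrow> translate S h f = f"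
      by blast
    then have "f \<noteq> \<one>\<^bsub>?V\<^esub>" by (auto simp: T.one_V)
    then show ?thesis
      using f subgroup.mem_carrier[OF H]
      by (intro bexI[of _ "(f, \<one>\<^bsub>N\<^esub>)"]) (auto simp: B.carrier_semidirect B.one_semidirect)
  qed
  \<comment> \<open>The module is nonzero: \<open>M\<close> itself is a subgroup not containing
    \<open>L\<close>.\<close>
  have "carrier ?B \<noteq> {\<one>\<^bsub>?B\<^esub>}"
    using fixer[OF normal_imp_subgroup[OF M]] psub by blast
  moreover have "fitting_subgroup ?B = kernel ?B N snd"
  proof (rule B.fitting_subgroup_semidirect[OF T.comm_group_V _ faithful])
    show "u = \<one>\<^bsub>?V\<^esub>" if "u \<in> carrier ?V" "u [^]\<^bsub>?V\<^esub> order N = \<one>\<^bsub>?V\<^esub>" for u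
      using T.pow_V_eq_one_imp[OF that(1) _ that(2)] coprime_r by simp
  qed
  ultimately have height': "has_fitting_height ?B (Suc k)"
    using has_fitting_height_Suc[OF B.group_hom_snd B.snd_surj _ _ height] by blast
  \<comment> \<open>The \<open>N\<close>-component dies by assumption on \<open>N\<close>, the
    module component already under \<open>L\<close>.\<close>
  have fixed': "fixed_points ?B P ?\<psi> = {\<one>\<^bsub>?B\<^esub>}"
  proof (intro equalityI subsetI)
    fix c assume c: "c \<in> fixed_points ?B P ?\<psi>"
    obtain f m where fm: "c = (f, m)" by (cases c)
    then have f: "f \<in> carrier ?V" and m: "m \<in> carrier N"
      and fix_f: "\<And>x. x \<in> carrier P \<Longrightarrow> translate S (\<one>\<^bsub>N\<^esub>, x) f = f"
      and fix_m: "\<And>x. x \<in> carrier P \<Longrightarrow> \<phi> x m = m"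
      using c by (auto simp: fixed_points_def B.carrier_semidirect)
    have "m = \<one>\<^bsub>N\<^esub>" using fixed m fix_m by (auto simp: fixed_points_def)
    moreover have "f = \<one>\<^bsub>?V\<^esub>"
      using fix_f LP by (intro T.translate_L_fixed_imp[OF f]) auto
    ultimately show "c \<in> {\<one>\<^bsub>?B\<^esub>}" using fm by (simp add: B.one_semidirect)
  next
    fix c assume "c \<in> {\<one>\<^bsub>?B\<^esub>}"
    then show "c \<in> fixed_points ?B P ?\<psi>"
      using group.is_monoid[OF B.group_semidirect] aut_action.act_fixes_one[OF action]
      by (auto simp: fixed_points_def monoid.one_closed)
  qed
  have trivM': "\<forall>m\<in>M. \<forall>b\<in>carrier ?B. ?\<psi> m b = b"
    using T.translate_M_trivial trivM by (auto simp: B.carrier_semidirect)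
  have fixL: "\<exists>c\<in>carrier ?B. c \<noteq> \<one>\<^bsub>?B\<^esub> \<and> ?\<psi> x c = c" if nontriv: "carrier N \<noteq> {\<one>\<^bsub>N\<^esub>}" and x: "x \<in> L" for x
  proof -
    obtain a where a: "a \<in> carrier N" "a \<noteq> \<one>\<^bsub>N\<^esub>" using nontriv N.one_closed by blast
    have "translate S (\<one>\<^bsub>N\<^esub>, x) \<one>\<^bsub>?V\<^esub> = \<one>\<^bsub>?V\<^esub>"
      using LP[OF x] by (intro \<theta>.act_fixes_one) (simp add: carrier_semidirect)
    then show ?thesis
      using a triv[OF x a(1)] 
      by (intro bexI[of _ "(\<one>\<^bsub>?V\<^esub>, a)"]) (auto simp: B.carrier_semidirect B.one_semidirect)
  qed
  have "finite (carrier ?B)" using T.finite_V finN by (simp add: B.carrier_semidirect)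
  moreover have "solvable ?B" using B.solvable_semidirect[OF V.solvable solv] .
  ultimately show ?thesis
    using action height' fixed' trivM' fixL fixer by (intro exI[of _ ?B] exI[of _ ?\<psi>]) blast
qed

text \<open>Each extension changes the element type. Copying the finite result back to
  \<open>nat\<close> keeps the type fixed throughout the induction.\<close>

lemma ex_nat_copy:
  assumes fin: "finite (carrier N)"
  shows "\<exists>(N' :: nat monoid) \<phi>' e. e \<in> iso N N' \<and> aut_action N' P \<phi>'
    \<and> (\<forall>x\<in>carrier P. \<forall>a\<in>carrier N. \<phi>' x (e a) = e (\<phi> x a))"
proof -
  obtain e :: "'b \<Rightarrow> nat" where inj: "inj_on e (carrier N)"
    using finite_imp_inj_to_nat_seg[OF fin] by blast
  let ?N = "image_group e N" and ?i = "inv_into (carrier N) e"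
  let ?\<phi> = "\<lambda>x a. e (\<phi> x (?i a))"
  have iso: "e \<in> iso N ?N" using inj by (rule inj_imp_image_group_iso)
  have "weak_group_morphism e {\<one>\<^bsub>N\<^esub>} N"
    using inj by (intro weak_group_morphismsI[OF N.one_is_normal])
      (auto simp: inj_on_eq_iff N.inv_solve_right')
  then interpret N': group ?N by (rule N.image_group_is_group)
  have "aut_action ?N P ?\<phi>"
    using inj by unfold_locales (auto simp: image_group_def act_mult act_comp)
  then show ?thesis
    using iso inj by (intro exI[of _ ?N] exI[of _ ?\<phi>] exI[of _ e]) auto
qed

end

section \<open>Induction along a chief series\<close>

lemma has_fitting_height_pos_imp_nontrivial:
  "has_fitting_height G k \<Longrightarrow> 0 < k \<Longrightarrow> carrier G \<noteq> {\<one>\<^bsub>G\<^esub>}"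
  by (auto simp: has_fitting_height_def)

text \<open>An action of the quotient by \<open>M\<close> is phrased as an action of
  \<open>G\<close> that is trivial on \<open>M\<close>, so \<open>G\<close> stays fixed while
  \<open>M\<close> shrinks. The centralised elements are claimed only at the bottom, where
  \<open>M\<close> is trivial.\<close>

lemma (in group) ex_aut_action_of_height:
  assumes p: "Factorial_Ring.prime p" and exponent: "\<And>x. x \<in> carrier G \<Longrightarrow> x [^] p = \<one>"
    and fin: "finite (carrier G)"
    and "M \<lhd> G" "order G = p ^ k * card M"
  shows "\<exists>(N :: nat monoid) \<phi>. aut_action N G \<phi> \<and> finite (carrier N) \<and> solvable N
    \<and> has_fitting_height N k \<and> fixed_points N G \<phi> = {\<one>\<^bsub>N\<^esub>} \<and> (\<forall>m\<in>M. \<forall>a\<in>carrier N. \<phi> m a = a)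
    \<and> (k > 1 \<and> M = {\<one>} \<longrightarrow> (\<forall>x\<in>carrier G. \<exists>c\<in>carrier N. c \<noteq> \<one>\<^bsub>N\<^esub> \<and> \<phi> x c = c))"
  using assms(4,5)
proof (induction k arbitrary: M)
  case 0
  let ?N = "\<lparr>carrier = {0}, monoid.mult = \<lambda>_ _. 0, one = 0\<rparr> :: nat monoid"
  have "group ?N" by (rule groupI) auto
  then have "aut_action ?N G (\<lambda>_ a. a)"
    by (auto simp: aut_action_def aut_action_axioms_def group_axioms)
  moreover have "solvable ?N"
    using solvable_seq.unity[of ?N] by (simp add: solvable_def)
  moreover have "fixed_points ?N G (\<lambda>_ a. a) = {\<one>\<^bsub>?N\<^esub>}" by (auto simp: fixed_points_def)
  ultimately show ?case
    by (intro exI[of _ ?N] exI[of _ "\<lambda>_ a. a"]) (auto simp: has_fitting_height_def)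
next
  case (Suc k)
  have pos: "0 < order G" using fin by (simp add: order_gt_0_iff_finite)
  obtain L where L: "L \<lhd> G" "M \<subseteq> L" "card L = p * card M"
    using ex_normal_extension_of_prime_index[OF p exponent Suc.prems(2) pos Suc.prems(1)] by blast
  have "card M > 0" using pos Suc.prems(2) by (metis mult_is_0 neq0_conv)
  then have "card M < card L" using L(3) prime_gt_1_nat[OF p] by simp
  then have psub: "M \<subset> L" using L(2) by blast
  have "order G = p ^ k * card L" using Suc.prems(2) L(3) by simp
  from Suc.IH[OF L(1) this] obtain N0 :: "nat monoid" and \<phi>0 where N0: "aut_action N0 G \<phi>0"
    "finite (carrier N0)" "solvable N0" "has_fitting_height N0 k" "fixed_points N0 G \<phi>0 = {\<one>\<^bsub>N0\<^esub>}"
    "\<forall>l\<in>L. \<forall>a\<in>carrier N0. \<phi>0 l a = a"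
    by blast
  obtain B :: "((nat \<times> 'a \<Rightarrow> int) \<times> nat) monoid" and \<psi> where B: "aut_action B G \<psi>"
    "finite (carrier B)" "solvable B" "has_fitting_height B (Suc k)" "fixed_points B G \<psi> = {\<one>\<^bsub>B\<^esub>}"
    "\<forall>m\<in>M. \<forall>b\<in>carrier B. \<psi> m b = b"
    and fixL: "carrier N0 \<noteq> {\<one>\<^bsub>N0\<^esub>} \<longrightarrow> (\<forall>x\<in>L. \<exists>c\<in>carrier B. c \<noteq> \<one>\<^bsub>B\<^esub> \<and> \<psi> x c = c)"
    and fixH: "\<forall>H. subgroup H G \<longrightarrow> M \<subseteq> H \<longrightarrow> \<not> L \<subseteq> H \<longrightarrow>
       (\<exists>c\<in>carrier B. c \<noteq> \<one>\<^bsub>B\<^esub> \<and> (\<forall>x\<in>H. \<psi> x c = c))"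
    using aut_action.ex_extension[OF N0(1,2) fin Suc.prems(1) L(1) psub N0(6,5,3,4)]
    by (elim exE conjE) (rule that)
  obtain N :: "nat monoid" and \<phi> e where iso: "e \<in> iso B N" and N: "aut_action N G \<phi>"
    and equiv: "\<And>x b. x \<in> carrier G \<Longrightarrow> b \<in> carrier B \<Longrightarrow> \<phi> x (e b) = e (\<psi> x b)"
    using aut_action.ex_nat_copy[OF B(1,2)] by blast
  interpret B: aut_action B G \<psi> by (rule B(1))
  interpret N: aut_action N G \<phi> by (rule N)
  interpret e: group_hom B N e
    using iso by (simp add: group_hom_def group_hom_axioms_def B.N.group_axioms N.N.group_axioms iso_iff)
  have surj: "carrier N = e ` carrier B" and inj: "inj_on e (carrier B)"
    using iso by (auto simp: iso_iff)
  have eq_iff: "e b = e b' \<longleftrightarrow> b = b'" if "b \<in> carrier B" "b' \<in> carrier B" for b b'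
    using that inj by (simp add: inj_on_eq_iff)
  have "finite (carrier N)" using B(2) surj by simp
  moreover have "solvable N" using e.surj_hom_imp_solvable B(3) surj by simp
  moreover have "has_fitting_height N (Suc k)"
    using has_fitting_height_iso[OF B.N.group_axioms N.N.group_axioms iso B(4)] .
  moreover have "fixed_points N G \<phi> = {\<one>\<^bsub>N\<^esub>}"
  proof -
    have "fixed_points N G \<phi> = e ` fixed_points B G \<psi>"
      unfolding fixed_points_def surj by (auto simp: equiv eq_iff)
    then show ?thesis using B(5) by simp
  qed
  moreover have "\<forall>m\<in>M. \<forall>a\<in>carrier N. \<phi> m a = a"
    using B(6) equiv subgroup.mem_carrier[OF normal_imp_subgroup[OF Suc.prems(1)]] by (auto simp: surj)
  moreover have "\<exists>c\<in>carrier N. c \<noteq> \<one>\<^bsub>N\<^esub> \<and> \<phi> x c = c"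
    if k: "Suc k > 1" and M: "M = {\<one>}" and x: "x \<in> carrier G" for x
  proof -
    let ?H = "generate G {x}"
    have H: "subgroup ?H G" using x by (intro generate_is_subgroup) simp
    have xH: "x \<in> ?H" by (rule generate.incl) simp
    have "\<exists>c\<in>carrier B. c \<noteq> \<one>\<^bsub>B\<^esub> \<and> \<psi> x c = c"
    \<comment> \<open>Here \<open>L\<close> has order \<open>p\<close> and \<open>?H\<close> has
      order dividing \<open>p\<close>. Containment thus means equality, so \<open>x\<close> lies in
      \<open>L\<close> and fixes the copy of \<open>N0\<close>, nontrivial because its height is
      positive. Otherwise the module supplies the fixed element.\<close>
    proof (cases "L \<subseteq> ?H")
      case True
      have "card ?H dvd p"
        using pow_eq_id[OF x] exponent[OF x] generate_pow_card[OF x] by simp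
      then have "card ?H \<le> card L"
        using L(3) M prime_gt_0_nat[OF p] by (simp add: dvd_imp_le)
      then have "L = ?H"
        using True card_seteq[OF _ True] finite_subset[OF subgroup.subset[OF H] fin] by blast
      moreover have "carrier N0 \<noteq> {\<one>\<^bsub>N0\<^esub>}"
        using has_fitting_height_pos_imp_nontrivial[OF N0(4)] k by simp
      ultimately show ?thesis using fixL xH by blast
    next
      case False
      then show ?thesis
        using fixH H M subgroup.one_closed[OF H] xH by blast
    qed
    then obtain c where c: "c \<in> carrier B" "c \<noteq> \<one>\<^bsub>B\<^esub>" "\<psi> x c = c" by blast
    then show ?thesis
      using eq_iff[OF c(1) B.N.one_closed] equiv[OF x c(1)] by (intro bexI[of _ "e c"]) auto
  qed
  ultimately show ?case using N by blast
qed

theorem theorem3p3: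
  fixes P :: "('a, 'c) monoid_scheme" and p n :: nat
  assumes "Factorial_Ring.prime p" and "group P" and "order P = p ^ n" and "n > 1"
    and "\<forall>x \<in> carrier P. x [^]\<^bsub>P\<^esub> p = \<one>\<^bsub>P\<^esub>"
  shows "\<exists>(N :: nat monoid) (\<phi> :: 'a \<Rightarrow> nat \<Rightarrow> nat).
           group N \<and> finite (carrier N) \<and> solvable N \<and> \<not> p dvd order N
         \<and> fitting_height N = n
         \<and> \<phi> \<in> hom P (AutoGroup N)
         \<and> fixed_points N P \<phi> = {\<one>\<^bsub>N\<^esub>}
         \<and> has_redundant_sylow p (semidirect_product N P \<phi>)"
proof -
  interpret P: group P by fact
  have "0 < order P" using assms(1,3) by (simp add: prime_gt_0_nat)
  then have fin: "finite (carrier P)" by (simp add: P.order_gt_0_iff_finite)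
  obtain N :: "nat monoid" and \<psi> where N: "aut_action N P \<psi>" "finite (carrier N)" "solvable N"
    "has_fitting_height N n" "fixed_points N P \<psi> = {\<one>\<^bsub>N\<^esub>}"
    and centralizer: "\<And>x. x \<in> carrier P \<Longrightarrow> \<exists>c\<in>carrier N. c \<noteq> \<one>\<^bsub>N\<^esub> \<and> \<psi> x c = c"
    using P.ex_aut_action_of_height[OF assms(1) bspec[OF assms(5)] fin P.one_is_normal, of n] assms(3,4)
    by auto
  interpret \<psi>: aut_action N P \<psi> by (rule N(1))
  \<comment> \<open>Members of \<open>AutoGroup N\<close> are extensional, so the action is
    restricted to the carrier.\<close>
  let ?\<phi> = "\<lambda>x. restrict (\<psi> x) (carrier N)"
  interpret \<phi>: aut_action N P ?\<phi>
    by unfold_locales (auto simp: \<psi>.act_mult \<psi>.act_comp)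
  have fixed: "fixed_points N P ?\<phi> = {\<one>\<^bsub>N\<^esub>}"
    using N(5) by (auto simp: fixed_points_def)
  have p': "\<not> p dvd order N"
    by (rule \<phi>.not_dvd_order_if_fixed_points_trivial[OF assms(1,3) N(2) fixed])
  have "\<exists>c\<in>carrier N. c \<noteq> \<one>\<^bsub>N\<^esub> \<and> ?\<phi> x c = c" if "x \<in> carrier P" for x
    using centralizer[OF that] by auto
  then have "has_redundant_sylow p (semidirect_product N P ?\<phi>)"
    by (rule \<phi>.has_redundant_sylowI[OF assms(1,3) N(2) p' fixed])
  then show ?thesis
    using N p' fixed \<psi>.restrict_act_hom_AutoGroup \<psi>.N.group_axioms has_fitting_height_imp_eq[OF N(4)]
    by blast
qed

end
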